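(* Let $\alpha>0$ and $\tilde\alpha:=2\sqrt2\,\alpha/3$. The kinetic function associated with the diffusive-dispersive model $\partial_tu+\partial_xu^3=\varepsilon u_{xx}+\delta u_{xxx}$ ($\varepsilon,\delta>0$, $\varepsilon/\sqrt\delta=\alpha$ fixed) is $$\varphi^\flat_\alpha(u_-)=\begin{cases}-u_--\tilde\alpha/2,&u_-\le-\tilde\alpha,\\-u_-/2,&|u_-|\le\tilde\alpha,\\-u_-+\tilde\alpha/2,&u_-\ge\tilde\alpha,\end{cases}$$ while the corresponding shock set is $$\mathcal{S}_\alpha(u_-)=\begin{cases}(u_-,\tilde\alpha/2]\cup\{-u_--\tilde\alpha/2\},&u_-\le-\tilde\alpha,\\ [-u_-/2,u_-),&-\tilde\alpha\le u_-\le\tilde\alpha,\\ \{-u_-+\tilde\alpha/2\}\cup[-\tilde\alpha/2,u_-),&u_-\ge\tilde\alpha,\end{cases}$$ where, in the middle case with $u_-\le 0$, the interval $[-u_-/2,u_-)$ is to be read as $(u_-,-u_-/2]$.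
   Context: A traveling wave connecting $u_-$ to $u_+\neq u_-$ is a solution $u=u(y)$, $y\in\mathbb{R}$, of $$\alpha u_y+u_{yy}=-\lambda(u-u_-)+u^3-u_-^3,\qquad\lambda=u_-^2+u_-u_++u_+^2,$$ with $\lim_{y\to\pm\infty}u(y)=u_\pm$ and $\lim_{y\to\pm\infty}u_y(y)=\lim_{y\to\pm\infty}u_{yy}(y)=0$ (here $y=(x-\lambda t)/\sqrt\delta$). The shock set $\mathcal{S}_\alpha(u_-)$ is the set of all right-hand states $u_+\ne u_-$ for which such a traveling wave exists. Kinetic function: a traveling wave connecting $u_-\ne0$ to $u_+$ is called nonclassical if $u_-u_+<0$ and $|u_+|>|u_-|/2$ (for $u_->0$ this means that $u_+$ is the smallest $u_2$ of the three roots $u_2<u_1<u_-$ of $u^3-u_-^3=\lambda(u-u_-)$). $\varphi^\flat_\alpha(u_-)$ is the (unique) right-hand state of a nonclassical traveling wave leaving from $u_-$ if one exists, and $\varphi^\flat_\alpha(u_-):=-u_-/2$ otherwise.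
   Formalization: In the outer cases of the shock set the interval endpoint is open, (u_-, α̃/2) and (-α̃/2, u_-): for |u_-| > α̃ no traveling wave reaches ±α̃/2, since the only orbit leaving u_- toward it at that speed ends at the nonclassical state, so the printed closed endpoint is false. *)

theory Defs
  imports Complex_Main
begin

text \<open>Travelling waves of the cubic diffusive-dispersive model
  \<open>u\<^sub>t + (u\<^sup>3)\<^sub>x = \<epsilon> u\<^sub>x\<^sub>x + \<delta> u\<^sub>x\<^sub>x\<^sub>x\<close> with \<open>\<epsilon>, \<delta> > 0\<close> and \<open>\<alpha> = \<epsilon> / sqrt \<delta>\<close>, in the
  variable \<open>y = (x - \<lambda> t) / sqrt \<delta>\<close>, after one integration.\<close>

definition shock_speed :: "real \<Rightarrow> real \<Rightarrow> real" where
  "shock_speed um up = um^2 + um * up + up^2"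

definition traveling_wave :: "real \<Rightarrow> real \<Rightarrow> real \<Rightarrow> (real \<Rightarrow> real) \<Rightarrow> bool" where
  "traveling_wave \<alpha> um up u \<longleftrightarrow> up \<noteq> um \<and>
     (\<exists>u' u''.
        (\<forall>y. (u has_real_derivative u' y) (at y)) \<and>
        (\<forall>y. (u' has_real_derivative u'' y) (at y)) \<and>
        (\<forall>y. \<alpha> * u' y + u'' y = - shock_speed um up * (u y - um) + (u y)^3 - um^3) \<and>
        (u \<longlongrightarrow> um) at_bot \<and> (u \<longlongrightarrow> up) at_top \<and>
        (u' \<longlongrightarrow> 0) at_bot \<and> (u' \<longlongrightarrow> 0) at_top \<and>
        (u'' \<longlongrightarrow> 0) at_bot \<and> (u'' \<longlongrightarrow> 0) at_top)"

text \<open>For \<open>um > alpha_tilde \<alpha>\<close> the state \<open>- alpha_tilde \<alpha> / 2\<close> is not in the shock set, although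
  the closed interval is sometimes printed: it shares its speed with the nonclassical state
  \<open>q = - um + alpha_tilde \<alpha> / 2\<close>. With \<open>k = 1 / sqrt 2\<close>, any wave leaving \<open>um\<close> with that speed has
  \<open>w = u' - k (u - um) (u - q)\<close> satisfying \<open>w' = - (\<alpha> + k (2 u - um - q)) w\<close>, whose coefficient
  is positive near \<open>um\<close>; as \<open>w\<close> vanishes at \<open>-\<infinity>\<close>, it vanishes identically, and then
  \<open>u' = k (u - um) (u - q)\<close> does not tend to \<open>0\<close> as \<open>u\<close> tends to \<open>- alpha_tilde \<alpha> / 2\<close>. The case
  \<open>um < - alpha_tilde \<alpha>\<close> is symmetric.\<close>

definition shock_set :: "real \<Rightarrow> real \<Rightarrow> real set" where
  "shock_set \<alpha> um = {up. \<exists>u. traveling_wave \<alpha> um up u}"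

definition nonclassical_state :: "real \<Rightarrow> real \<Rightarrow> real \<Rightarrow> bool" where
  "nonclassical_state \<alpha> um up \<longleftrightarrow>
     (\<exists>u. traveling_wave \<alpha> um up u) \<and> um * up < 0 \<and> \<bar>up\<bar> > \<bar>um\<bar> / 2"

text \<open>Uniqueness of the nonclassical right-hand state is not assumed: any claim about the
  value of \<open>kinetic_function\<close> in the first branch requires proving it.\<close>

definition kinetic_function :: "real \<Rightarrow> real \<Rightarrow> real" where
  "kinetic_function \<alpha> um =
     (if \<exists>up. nonclassical_state \<alpha> um up then (THE up. nonclassical_state \<alpha> um up) else - um / 2)"

definition alpha_tilde :: "real \<Rightarrow> real" where
  "alpha_tilde \<alpha> = 2 * sqrt 2 * \<alpha> / 3"

end

theory Submission
  imports Defs "HOL-Analysis.Analysis"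
begin

text \<open>
  Write \<open>a > 0\<close> for the left state and \<open>q \<le> r < a\<close> for the roots of the cubic of a given speed. With
  \<open>k = 1 / sqrt 2\<close>, the defect \<open>w = u' - k (u - a) (u - q)\<close> satisfies a linear first-order equation
  with forcing \<open>3/2 (a + q - alpha_tilde \<alpha> / 2) (u - a) (u - q)\<close>. An orbit leaving \<open>a\<close> has
  \<open>w \<rightarrow> 0\<close> at \<open>-\<infinity>\<close>, so the sign of \<open>a + q - alpha_tilde \<alpha> / 2\<close> decides on which side of the
  parabola \<open>u' = k (u - a) (u - q)\<close> it stays: above it the orbit is trapped in \<open>(q, a)\<close> and energy
  dissipation drives it to \<open>r\<close>; on it the orbit is an explicit logistic profile ending at \<open>q\<close>; below it
  the orbit crosses \<open>q\<close> and never returns. Negative left states follow by the symmetry \<open>u \<mapsto> -u\<close>.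
\<close>

section \<open>A nonlinear Volterra equation\<close>

text \<open>The parabola comes from a quadratic ansatz for u' as a function of u. Matching leading
  coefficients forces 2 k^2 = 1, and the constant that remains is the forcing;
  \<open>alpha_tilde\<close> is the left state a at which this constant vanishes for the double root
  q = r = - a / 2. The logistic profile covers only the speeds without forcing. For the others the
  orbit leaving a has no formula, and since a is a saddle it solves a problem posed at -infinity.
  The substitution \<tau> = exp (\<mu> y) moves -infinity to the regular point \<tau> = 0, which is
  why a Volterra equation is solved. The nonexistence half concerns every wave with the given ends,
  so the comparisons are proved for arbitrary orbits with limits a and 0 at -infinity. End states
  outside [- a, a) are removed by an energy balance; this is what makes a the largest root.\<close>

lemma volterra_fixpoint:
  fixes f :: "real \<Rightarrow> real \<Rightarrow> real" and \<phi> :: "real \<Rightarrow> real"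
  assumes f: "continuous_on UNIV (\<lambda>(s, x). f s x)"
    and bound: "\<And>s x. \<bar>f s x\<bar> \<le> M"
    and lip: "\<And>s x y. \<bar>f s x - f s y\<bar> \<le> K * \<bar>x - y\<bar>"
    and \<phi>: "continuous_on {0..1} \<phi>" "\<And>t. t \<in> {0..1} \<Longrightarrow> 0 \<le> \<phi> t \<and> \<phi> t \<le> 1"
  obtains X where "continuous_on UNIV X"
    and "\<And>\<tau>. \<tau> \<ge> 0 \<Longrightarrow> X \<tau> = x\<^sub>0 + \<tau> * integral {0..1} (\<lambda>t. \<phi> t * f (\<tau> * t) (X (\<tau> * t)))"
proof -
  have M: "M \<ge> 0" using bound[of 0 0] by linarith
  have K: "K \<ge> 0" using lip[of 0 1 0] by simp
  \<comment> \<open>The contraction constant becomes K / L, at most 1/2 by this choice; the summand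
    1 keeps L positive when K = 0.\<close>
  define L where "L = 2 * K + 1"
  have L: "L > 0" using K by (simp add: L_def)
  \<comment> \<open>The integral operator acts on the weighted unknown \<open>Y \<tau> = exp (- L \<bar>\<tau>\<bar>) * X \<tau>\<close>; the weight makes it
    a contraction, and \<open>\<bar>\<tau>\<bar>\<close> extends it to bounded continuous functions on the whole line.\<close>
  define h where "h Y \<tau> t = \<phi> t * f (\<bar>\<tau>\<bar> * t) (exp (L * \<bar>\<tau>\<bar> * t) * apply_bcontfun Y (\<bar>\<tau>\<bar> * t))"
    for Y :: "real \<Rightarrow>\<^sub>C real" and \<tau> t
  define G where "G Y \<tau> = exp (- L * \<bar>\<tau>\<bar>) * (x\<^sub>0 + \<bar>\<tau>\<bar> * integral {0..1} (h Y \<tau>))" for Y \<tau>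
  have apply_cont: "continuous_on S (\<lambda>x. apply_bcontfun Y (g x))" if "continuous_on S g"
    for Y :: "real \<Rightarrow>\<^sub>C real" and S :: "'x::topological_space set" and g
    by (rule continuous_on_compose2[OF continuous_on_apply_bcontfun[of UNIV Y] that]) auto
  have f_cont: "continuous_on S (\<lambda>x. f (g x) (k x))" if "continuous_on S g" "continuous_on S k"
    for S :: "'x::topological_space set" and g k
    using continuous_on_compose2[OF f continuous_on_Pair[OF that]] by simp
  \<comment> \<open>The interval [0, 1] and the factor \<tau> result from s = \<tau> t in a Volterra
    integral over [0, \<tau>]. All dependence on \<tau> then sits in the integrand, and continuity
    of \<open>G\<close> is that of a parameter integral.\<close>
  have h_cont2: "continuous_on (UNIV \<times> cbox 0 1) (\<lambda>(\<tau>, t). h Y \<tau> t)" for Y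
    unfolding h_def case_prod_beta
    by (intro continuous_intros f_cont apply_cont continuous_on_compose2[OF \<phi>(1)]) auto
  have h_cont: "continuous_on {0..1} (h Y \<tau>)" for Y \<tau>
    unfolding h_def by (intro continuous_intros f_cont apply_cont \<phi>(1))
  have h_int: "h Y \<tau> integrable_on {0..1}" for Y \<tau>
    by (rule integrable_continuous_real[OF h_cont])
  have h_bound: "\<bar>h Y \<tau> t\<bar> \<le> M" if "t \<in> {0..1}" for Y \<tau> t
    unfolding h_def abs_mult using \<phi>(2)[OF that] mult_mono[of "\<bar>\<phi> t\<bar>" 1, OF _ bound] by auto
  have G_cont: "continuous_on UNIV (G Y)" for Y
  proof -
    have "continuous_on UNIV (\<lambda>\<tau>. integral (cbox 0 1) (h Y \<tau>))"
      by (rule integral_continuous_on_param[OF h_cont2])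
    thus ?thesis unfolding G_def by (intro continuous_intros) simp
  qed
  have G_bound: "norm (G Y \<tau>) \<le> \<bar>x\<^sub>0\<bar> + M / L" for Y \<tau>
  proof -
    have i: "\<bar>integral {0..1} (h Y \<tau>)\<bar> \<le> M"
      using integral_bound[of 0 1 "h Y \<tau>" M] h_cont h_bound by simp
    have "L * \<bar>\<tau>\<bar> \<le> exp (L * \<bar>\<tau>\<bar>)"
      using exp_ge_add_one_self[of "L * \<bar>\<tau>\<bar>"] by linarith
    hence e: "exp (- L * \<bar>\<tau>\<bar>) * \<bar>\<tau>\<bar> \<le> 1 / L"
      using L by (simp add: exp_minus field_simps)
    have "\<bar>G Y \<tau>\<bar> \<le> exp (- L * \<bar>\<tau>\<bar>) * \<bar>x\<^sub>0\<bar> + exp (- L * \<bar>\<tau>\<bar>) * \<bar>\<tau>\<bar> * \<bar>integral {0..1} (h Y \<tau>)\<bar>"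
      unfolding G_def using abs_triangle_ineq[of x\<^sub>0 "\<bar>\<tau>\<bar> * integral {0..1} (h Y \<tau>)"]
      by (simp add: abs_mult ring_distribs flip: distrib_left mult.assoc)
         (simp add: abs_mult mult.assoc flip: distrib_left)
    also have "\<dots> \<le> 1 * \<bar>x\<^sub>0\<bar> + 1 / L * M"
      using L by (intro add_mono mult_mono e i) auto
    finally show ?thesis by simp
  qed
  have G_ap: "apply_bcontfun (Bcontfun (G Y)) = G Y" for Y
    by (rule Bcontfun_inverse) (rule bcontfun_normI[OF G_cont G_bound])
  have contr: "dist (Bcontfun (G Y)) (Bcontfun (G Z)) \<le> 1 / 2 * dist Y Z" for Y Z
  proof (rule dist_bound)
    fix \<tau> :: real
    define d where "d = dist Y Z"
    have d: "\<bar>apply_bcontfun Y s - apply_bcontfun Z s\<bar> \<le> d" for s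
      using dist_bounded[of Y s Z] by (simp add: d_def dist_real_def)
    have d0: "d \<ge> 0" by (simp add: d_def)
    have le: "\<bar>h Y \<tau> t - h Z \<tau> t\<bar> \<le> K * d * exp (L * \<bar>\<tau>\<bar> * t)" if t: "t \<in> {0..1}" for t
    proof -
      let ?e = "exp (L * \<bar>\<tau>\<bar> * t)" and ?Y = "apply_bcontfun Y (\<bar>\<tau>\<bar> * t)" and ?Z = "apply_bcontfun Z (\<bar>\<tau>\<bar> * t)"
      have "\<bar>h Y \<tau> t - h Z \<tau> t\<bar> = \<phi> t * \<bar>f (\<bar>\<tau>\<bar> * t) (?e * ?Y) - f (\<bar>\<tau>\<bar> * t) (?e * ?Z)\<bar>"
        using \<phi>(2)[OF t] by (simp add: h_def abs_mult flip: right_diff_distrib)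
      also have "\<dots> \<le> 1 * (K * \<bar>?e * ?Y - ?e * ?Z\<bar>)"
        using \<phi>(2)[OF t] K by (intro mult_mono lip) auto
      also have "\<dots> = K * (?e * \<bar>?Y - ?Z\<bar>)" by (simp add: abs_mult flip: right_diff_distrib)
      also have "\<dots> \<le> K * (?e * d)" using d K by (intro mult_left_mono) auto
      finally show ?thesis by (simp add: mult_ac)
    qed
    \<comment> \<open>Integrating exp (L |\<tau>| t) over t gains 1 / (L |\<tau>|), which absorbs
      the factor |\<tau>| and supplies the small 1 / L.\<close>
    have key: "\<bar>\<tau>\<bar> * \<bar>integral {0..1} (h Y \<tau>) - integral {0..1} (h Z \<tau>)\<bar> \<le> K * d / L * exp (L * \<bar>\<tau>\<bar>)"
    proof (cases "\<tau> = 0")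
      case True thus ?thesis using K d0 L by simp
    next
      case False
      have I: "((\<lambda>t. K * d * exp (L * \<bar>\<tau>\<bar> * t)) has_integral
         (K * d / (L * \<bar>\<tau>\<bar>) * exp (L * \<bar>\<tau>\<bar> * 1) - K * d / (L * \<bar>\<tau>\<bar>) * exp (L * \<bar>\<tau>\<bar> * 0))) {0..1}"
        using L False
        by (intro fundamental_theorem_of_calculus)
           (auto intro!: derivative_eq_intros simp flip: has_real_derivative_iff_has_vector_derivative)
      have "\<bar>integral {0..1} (\<lambda>t. h Y \<tau> t - h Z \<tau> t)\<bar> \<le> integral {0..1} (\<lambda>t. K * d * exp (L * \<bar>\<tau>\<bar> * t))"
        using integral_norm_bound_integral[of "\<lambda>t. h Y \<tau> t - h Z \<tau> t" "{0..1}"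
            "\<lambda>t. K * d * exp (L * \<bar>\<tau>\<bar> * t)"] le I h_int
        by (auto intro: integrable_diff has_integral_integrable)
      also have "\<dots> = K * d / (L * \<bar>\<tau>\<bar>) * exp (L * \<bar>\<tau>\<bar> * 1) - K * d / (L * \<bar>\<tau>\<bar>) * exp (L * \<bar>\<tau>\<bar> * 0)"
        by (rule integral_unique[OF I])
      also have "\<dots> \<le> K * d / (L * \<bar>\<tau>\<bar>) * exp (L * \<bar>\<tau>\<bar>)" using K d0 L by simp
      finally have "\<bar>\<tau>\<bar> * \<bar>integral {0..1} (\<lambda>t. h Y \<tau> t - h Z \<tau> t)\<bar> \<le> \<bar>\<tau>\<bar> * (K * d / (L * \<bar>\<tau>\<bar>) * exp (L * \<bar>\<tau>\<bar>))"
        by (rule mult_left_mono) simp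
      also have "\<dots> = K * d / L * exp (L * \<bar>\<tau>\<bar>)" using False by simp
      finally show ?thesis using h_int by (simp add: Henstock_Kurzweil_Integration.integral_diff)
    qed
    have "dist (G Y \<tau>) (G Z \<tau>) = exp (- L * \<bar>\<tau>\<bar>) * (\<bar>\<tau>\<bar> * \<bar>integral {0..1} (h Y \<tau>) - integral {0..1} (h Z \<tau>)\<bar>)"
      unfolding G_def dist_real_def by (simp add: abs_mult flip: right_diff_distrib)
    also have "\<dots> \<le> exp (- L * \<bar>\<tau>\<bar>) * (K * d / L * exp (L * \<bar>\<tau>\<bar>))"
      by (intro mult_left_mono key) simp
    also have "\<dots> = K / L * d" by (simp add: exp_minus)
    also have "\<dots> \<le> 1 / 2 * d" using d0 L by (intro mult_right_mono) (auto simp: L_def field_simps)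
    finally show "dist (apply_bcontfun (Bcontfun (G Y)) \<tau>) (apply_bcontfun (Bcontfun (G Z)) \<tau>) \<le> 1 / 2 * dist Y Z"
      by (simp add: G_ap d_def)
  qed
  obtain Y where Y: "Bcontfun (G Y) = Y"
    using banach_fix_type[of "1/2" "\<lambda>Y. Bcontfun (G Y)"] contr by auto
  define X where "X \<tau> = exp (L * \<bar>\<tau>\<bar>) * apply_bcontfun Y \<tau>" for \<tau>
  show ?thesis
  proof
    show "continuous_on UNIV X" unfolding X_def by (intro continuous_intros apply_cont)
    show "X \<tau> = x\<^sub>0 + \<tau> * integral {0..1} (\<lambda>t. \<phi> t * f (\<tau> * t) (X (\<tau> * t)))" if "\<tau> \<ge> 0" for \<tau>
    proof -
      have "apply_bcontfun Y \<tau> = G Y \<tau>" using G_ap[of Y] Y by simp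
      moreover have "integral {0..1} (h Y \<tau>) = integral {0..1} (\<lambda>t. \<phi> t * f (\<tau> * t) (X (\<tau> * t)))"
        using that by (intro integral_cong) (simp add: h_def X_def abs_mult mult.assoc)
      ultimately show ?thesis using that by (simp add: X_def G_def exp_minus)
    qed
  qed
qed

section \<open>Calculus on the real line\<close>

text \<open>The hypotheses stop at T, and the sign is asked only before T, so that T may be an exit
  time at which the differential equation and the strict bounds on the orbit end.\<close>

lemma nonincreasing_le_limit_at_bot:
  fixes f f' :: "real \<Rightarrow> real"
  assumes deriv: "\<And>y. y \<le> T \<Longrightarrow> (f has_real_derivative f' y) (at y)"
    and nonpos: "\<And>y. y < T \<Longrightarrow> f' y \<le> 0"
    and lim: "(f \<longlongrightarrow> L) at_bot"
  shows "f T \<le> L"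
proof (rule tendsto_lowerbound[OF lim])
  show "eventually (\<lambda>y. f T \<le> f y) at_bot"
  proof (rule eventually_mono[OF eventually_le_at_bot[of T]])
    fix y assume y: "y \<le> T"
    show "f T \<le> f y"
    proof (rule DERIV_nonpos_imp_decreasing_open[OF y])
      show "continuous_on {y..T} f"
        by (rule DERIV_continuous_on) (auto intro: has_field_derivative_at_within deriv)
    qed (use deriv nonpos less_imp_le in blast)
  qed
qed simp

lemma decreasing_less_limit_at_bot:
  fixes f f' :: "real \<Rightarrow> real"
  assumes deriv: "\<And>y. y \<le> T \<Longrightarrow> (f has_real_derivative f' y) (at y)"
    and neg: "\<And>y. y < T \<Longrightarrow> f' y < 0"
    and lim: "(f \<longlongrightarrow> L) at_bot"
  shows "f T < L"
proof -
  have "f (T - 1) \<le> L"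
    by (rule nonincreasing_le_limit_at_bot[of _ f f', OF _ _ lim]) (use deriv neg in \<open>auto intro: less_imp_le\<close>)
  moreover have "f T < f (T - 1)"
  proof (rule DERIV_neg_imp_decreasing_open[of "T - 1" T])
    show "continuous_on {T - 1..T} f"
      by (rule DERIV_continuous_on) (auto intro: has_field_derivative_at_within deriv)
  qed (simp, use deriv neg less_imp_le in blast)
  ultimately show ?thesis by simp
qed

lemma limit_at_top_le_nonincreasing:
  fixes f f' :: "real \<Rightarrow> real"
  assumes deriv: "\<And>y. y \<ge> T \<Longrightarrow> (f has_real_derivative f' y) (at y)"
    and nonpos: "\<And>y. y \<ge> T \<Longrightarrow> f' y \<le> 0"
    and lim: "(f \<longlongrightarrow> L) at_top"
  shows "L \<le> f T"
proof (rule tendsto_upperbound[OF lim])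
  show "eventually (\<lambda>y. f y \<le> f T) at_top"
    by (rule eventually_mono[OF eventually_ge_at_top[of T]])
       (rule DERIV_nonpos_imp_nonincreasing, use deriv nonpos in auto)
qed simp

lemma first_hitting_time:
  fixes f :: "real \<Rightarrow> real"
  assumes "continuous_on UNIV f" and "eventually (\<lambda>y. f y > 0) at_bot" and "f b \<le> 0"
  shows "\<exists>t. f t = 0 \<and> (\<forall>y<t. f y > 0)"
proof -
  obtain N where N: "\<And>y. y \<le> N \<Longrightarrow> f y > 0" using assms(2) by (auto simp: eventually_at_bot_linorder)
  define S where "S = {N..b} \<inter> f -` {..0}"
  have "closed S" unfolding S_def
    by (intro continuous_closed_preimage continuous_on_subset[OF assms(1)]) auto
  hence "compact S" unfolding S_def by (simp add: compact_eq_bounded_closed bounded_Int)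
  moreover have "b \<in> S" using N[of b] assms(3) by (cases "b \<le> N") (auto simp: S_def)
  hence "S \<noteq> {}" by blast
  ultimately obtain t where t: "t \<in> S" "\<And>y. y \<in> S \<Longrightarrow> t \<le> y"
    using compact_attains_inf[of S] by metis
  have pos: "f y > 0" if "y < t" for y
    using N[of y] t(2)[of y] t(1) that by (force simp: S_def)
  \<comment> \<open>Membership in \<open>S\<close> gives f t \<le> 0; the left limit of positive
    values gives the other inequality.\<close>
  have "f t \<ge> 0"
  proof (rule tendsto_lowerbound)
    have "isCont f t" using assms(1) by (simp add: continuous_on_eq_continuous_at)
    thus "(f \<longlongrightarrow> f t) (at_left t)" using continuous_within filterlim_at_split isCont_def by blast
    show "eventually (\<lambda>y. 0 \<le> f y) (at_left t)"
      unfolding eventually_at_filter using pos by (auto intro!: always_eventually less_imp_le)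
  qed simp
  with t(1) have "f t = 0" by (simp add: S_def)
  thus ?thesis using pos by blast
qed

lemma deriv_nonpos_if_left_ge:
  fixes f :: "real \<Rightarrow> real"
  assumes "(f has_real_derivative D) (at t)" and "s < t" and "\<And>y. s < y \<Longrightarrow> y < t \<Longrightarrow> f y \<ge> f t"
  shows "D \<le> 0"
proof (rule ccontr)
  assume "\<not> D \<le> 0"
  then obtain d where d: "d > 0" "\<And>h. 0 < h \<Longrightarrow> h < d \<Longrightarrow> f (t - h) < f t"
    using DERIV_pos_inc_left[OF assms(1)] by auto
  define h where "h = min (d / 2) ((t - s) / 2)"
  have "0 < h" "h < d" "s < t - h" using d(1) assms(2) by (auto simp: h_def min_def field_simps)
  thus False using d(2)[of h] assms(3)[of "t - h"] by auto
qed

text \<open>A form of Barbalat's lemma: f' varies slowly, so a value of f' that is not small would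
  move f by a fixed amount over a fixed length, against its convergence.\<close>

lemma deriv_tendsto_zero_at_top:
  fixes f f' f'' :: "real \<Rightarrow> real"
  assumes f: "\<And>y. (f has_real_derivative f' y) (at y)"
    and f': "\<And>y. (f' has_real_derivative f'' y) (at y)"
    and bound: "\<And>y. \<bar>f'' y\<bar> \<le> M"
    and lim: "(f \<longlongrightarrow> L) at_top"
  shows "(f' \<longlongrightarrow> 0) at_top"
proof (rule tendstoI)
  fix e :: real assume e: "e > 0"
  have M: "M \<ge> 0" using bound[of 0] by linarith
  define h where "h = e / (2 * (M + 1))"
  have h: "h > 0" using e M by (simp add: h_def)
  have hM: "h * M < e / 2" using e M by (simp add: h_def field_simps)
  have "((\<lambda>y. f (y + h)) \<longlongrightarrow> L) at_top"
    by (rule filterlim_compose[OF lim]) (auto intro: filterlim_at_top_add_at_top filterlim_tendsto_add_at_top filterlim_ident simp: add.commute[of _ h])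
  from tendsto_diff[OF this lim] have "((\<lambda>y. f (y + h) - f y) \<longlongrightarrow> 0) at_top" by simp
  hence "eventually (\<lambda>y. dist (f (y + h) - f y) 0 < h * (e / 2)) at_top"
    using e h by (intro tendstoD) auto
  thus "eventually (\<lambda>y. dist (f' y) 0 < e) at_top"
  proof eventually_elim
    case (elim y)
    obtain x where x: "y < x" "x < y + h" "f (y + h) - f y = (y + h - y) * f' x"
      using MVT2[of y "y + h" f f'] f h by auto
    obtain x' where x': "y < x'" "x' < x" "f' x - f' y = (x - y) * f'' x'"
      using MVT2[of y x f' f''] f' x by auto
    have "\<bar>f' x - f' y\<bar> \<le> h * M"
      unfolding x'(3) abs_mult using x bound[of x'] by (intro mult_mono) auto
    moreover have "h * \<bar>f' x\<bar> < h * (e / 2)" using elim h x by (simp add: abs_mult)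
    ultimately show ?case using hM h by simp
  qed
qed

text \<open>Some cluster point l is a root. To wander off, u would have to pass l + d or l - d,
  where g is nonzero once d avoids the distances from l to the finitely many roots; smallness of g
  (u y) rules this out.\<close>

lemma converges_to_root:
  fixes u g :: "real \<Rightarrow> real"
  assumes u: "continuous_on UNIV u" and bdd: "\<And>y. lo \<le> u y \<and> u y \<le> hi"
    and g: "continuous_on UNIV g" and fin: "finite {x. g x = 0}"
    and lim: "((\<lambda>y. g (u y)) \<longlongrightarrow> 0) at_top"
  obtains l where "g l = 0" "(u \<longlongrightarrow> l) at_top"
proof -
  have "seq_compact {lo..hi}" by (simp add: compact_imp_seq_compact)
  from seq_compactE[OF this, of "\<lambda>n. u (real n)"] bdd
  obtain l r where lr: "strict_mono (r::nat\<Rightarrow>nat)" "((\<lambda>n. u (real n)) \<circ> r) \<longlonglongrightarrow> l"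
    by (metis atLeastAtMost_iff)
  have rt: "filterlim (\<lambda>n. real (r n)) at_top sequentially"
    using filterlim_compose[OF filterlim_real_sequentially filterlim_subseq[OF lr(1)]] by simp
  have "isCont g l" using g by (simp add: continuous_on_eq_continuous_at)
  hence "(\<lambda>n. g (u (real (r n)))) \<longlonglongrightarrow> g l" using isCont_tendsto_compose[OF _ lr(2)] by (simp add: o_def)
  moreover have "(\<lambda>n. g (u (real (r n)))) \<longlonglongrightarrow> 0" using filterlim_compose[OF lim rt] by simp
  ultimately have gl: "g l = 0" by (rule LIMSEQ_unique)
  have "(u \<longlongrightarrow> l) at_top"
  proof (rule tendstoI)
    fix e :: real assume e: "e > 0"
    let ?bad = "(\<lambda>x. x - l) ` {x. g x = 0} \<union> (\<lambda>x. l - x) ` {x. g x = 0}"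
    have "\<not> {0<..<e} \<subseteq> ?bad" using infinite_Ioo[OF e] fin finite_subset by blast
    then obtain d where "d \<in> {0<..<e}" "d \<notin> ?bad" by blast
    hence d: "0 < d" "d < e" and bad: "d \<notin> ?bad" by (auto simp del: Un_iff)
    have nz: "g (l + d) \<noteq> 0" "g (l - d) \<noteq> 0"
      using bad image_eqI[of d "\<lambda>x. x - l" "l + d" "{x. g x = 0}"]
        image_eqI[of d "\<lambda>x. l - x" "l - d" "{x. g x = 0}"] by auto
    have "eventually (\<lambda>y. dist (g (u y)) 0 < min \<bar>g (l + d)\<bar> \<bar>g (l - d)\<bar>) at_top"
      using nz by (intro tendstoD[OF lim]) auto
    then obtain N where N: "\<And>y. y \<ge> N \<Longrightarrow> \<bar>g (u y)\<bar> < min \<bar>g (l + d)\<bar> \<bar>g (l - d)\<bar>"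
      by (auto simp: eventually_at_top_linorder)
    have "eventually (\<lambda>n. dist (u (real (r n))) l < d \<and> real (r n) \<ge> N) sequentially"
      using tendstoD[OF lr(2) d(1)] rt by (auto simp: o_def filterlim_at_top eventually_conj_iff)
    then obtain n where n: "dist (u (real (r n))) l < d" "real (r n) \<ge> N"
      by (auto simp: eventually_sequentially)
    have "dist (u y) l < e" if y: "y \<ge> real (r n)" for y
    proof (rule ccontr)
      assume "\<not> dist (u y) l < e"
      hence far: "\<bar>u y - l\<bar> \<ge> d" using d by (simp add: dist_real_def)
      have c: "continuous_on {real (r n)..y} (\<lambda>x. \<bar>u x - l\<bar>)"
        by (intro continuous_intros continuous_on_subset[OF u]) auto
      obtain x where x: "real (r n) \<le> x" "\<bar>u x - l\<bar> = d"
        using IVT'[of "\<lambda>x. \<bar>u x - l\<bar>", OF _ far y c] n(1) by (auto simp: dist_real_def)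
      hence "u x = l + d \<or> u x = l - d" by (auto simp: abs_if split: if_splits)
      thus False using N[of x] x(1) n(2) by auto
    qed
    thus "eventually (\<lambda>y. dist (u y) l < e) at_top" by (auto simp: eventually_at_top_linorder)
  qed
  thus ?thesis using that gl by blast
qed

section \<open>The unstable manifold of the left state\<close>

lemma integral_at_has_real_derivative:
  fixes n :: "real \<Rightarrow> real"
  assumes "continuous_on {0..} n" "\<tau> > 0"
  shows "((\<lambda>\<tau>. integral {0..\<tau>} n) has_real_derivative n \<tau>) (at \<tau>)"
proof -
  have "continuous_on {0..\<tau> + 1} n" using assms(1) by (rule continuous_on_subset) auto
  from integral_has_real_derivative[OF this, of \<tau>]
  show ?thesis using assms(2) by (simp add: at_within_Icc_at)
qed

lemma clamp_lipschitz:
  fixes x y l :: real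
  shows "\<bar>max l (min x 0) - max l (min y 0)\<bar> \<le> \<bar>x - y\<bar>"
  by (simp add: max_def min_def)

text \<open>
  Put \<open>\<tau> = exp (\<mu> y)\<close> with \<open>\<mu>\<close> the unstable eigenvalue and \<open>z = \<tau> X(\<tau>)\<close>. Variation of constants turns
  the equation, together with the normalisation \<open>X(0) = -1\<close>, into the regular Volterra equation
  \<open>X(\<tau>) = -1 + c \<integral>\<^sub>0\<^sup>\<tau> (1 - (s/\<tau>)\<^sup>\<theta>) m(s, X(s)) ds\<close> with \<open>m(\<tau>, X) = X\<^sup>2 (3a + \<tau> X)\<close>. Cutting \<open>X\<close> off to
  \<open>[- min 1 (3a/\<tau>), 0]\<close> makes \<open>m\<close> bounded, nonnegative and globally Lipschitz. Then \<open>X \<ge> -1\<close>, so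
  the cut-off is inactive wherever \<open>- 3a \<le> z \<le> 0\<close>.
\<close>

lemma unstable_orbit:
  fixes a \<alpha> \<gamma> :: real
  assumes a: "a > 0" and \<gamma>: "\<gamma> > 0"
  obtains z z' where "\<And>y. (z has_real_derivative z' y) (at y)"
    and "\<And>y. - (3 * a) \<le> z y \<Longrightarrow> z y \<le> 0 \<Longrightarrow>
           (z' has_real_derivative \<gamma> * z y + 3 * a * (z y)^2 + (z y)^3 - \<alpha> * z' y) (at y)"
    and "(z \<longlongrightarrow> 0) at_bot" and "(z' \<longlongrightarrow> 0) at_bot"
    and "eventually (\<lambda>y. z y < 0) at_bot"
proof -
  define D where "D = sqrt (\<alpha>^2 + 4 * \<gamma>)"
  have D2: "D^2 = \<alpha>^2 + 4 * \<gamma>" unfolding D_def using \<gamma> by simp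
  have D: "\<bar>\<alpha>\<bar> < D" unfolding D_def using \<gamma> by (intro real_less_rsqrt) simp
  define \<mu> where "\<mu> = (- \<alpha> + D) / 2"
  define \<nu> where "\<nu> = (- \<alpha> - D) / 2"
  have \<mu>: "\<mu> > 0" and \<nu>: "\<nu> < 0" using D by (auto simp: \<mu>_def \<nu>_def)
  have sum: "\<mu> + \<nu> = - \<alpha>" by (simp add: \<mu>_def \<nu>_def field_simps)
  have "\<mu> * \<nu> = (\<alpha>^2 - D^2) / 4" by (simp add: \<mu>_def \<nu>_def field_simps power2_eq_square)
  hence prod: "\<mu> * \<nu> = - \<gamma>" by (simp add: D2)
  \<comment> \<open>In the variable s = exp (\<mu> t), the variation-of-constants kernel (exp (\<mu>
    (y - t)) - exp (\<nu> (y - t))) / (\<mu> - \<nu>), divided by \<tau>, is 1 - (s /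
    \<tau>)^\<theta> up to a factor free of \<tau>. The constant \<open>c\<close> is 1 / (\<mu>
    (\<mu> - \<nu>)).\<close>
  define \<theta> where "\<theta> = 1 - \<nu> / \<mu>"
  have \<theta>: "\<theta> > 1" using \<mu> \<nu> by (simp add: \<theta>_def divide_neg_pos)
  have \<theta>\<mu>: "\<mu> * (1 - \<theta>) = \<nu>" using \<mu> by (simp add: \<theta>_def)
  define c where "c = 1 / (\<mu>^2 * \<theta>)"
  have c: "c > 0" using \<mu> \<theta> by (simp add: c_def)
  \<comment> \<open>The quotient equals min 1 (3 a / \<tau>) for \<tau> > 0 and stays 1 for all
    \<tau> \<le> 3 a, so the cut-off is continuous across \<tau> = 0.\<close>
  define p where "p \<tau> x = max (- (3 * a / max \<tau> (3 * a))) (min x 0)" for \<tau> x :: real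
  define m where "m \<tau> x = (p \<tau> x)^2 * (3 * a + max 0 \<tau> * p \<tau> x)" for \<tau> x :: real
  have p: "- 1 \<le> p \<tau> x" "p \<tau> x \<le> 0" "- (3 * a) \<le> max 0 \<tau> * p \<tau> x" for \<tau> x
  proof -
    let ?b = "3 * a / max \<tau> (3 * a)"
    have b: "0 \<le> ?b" "?b \<le> 1" using a by (auto simp: divide_simps)
    thus "- 1 \<le> p \<tau> x" "p \<tau> x \<le> 0" by (auto simp: p_def)
    have "max 0 \<tau> * ?b \<le> 3 * a" using a by (auto simp: max_def field_simps)
    moreover have "max 0 \<tau> * (- ?b) \<le> max 0 \<tau> * p \<tau> x"
      by (rule mult_left_mono) (auto simp: p_def)
    ultimately show "- (3 * a) \<le> max 0 \<tau> * p \<tau> x" by simp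
  qed
  have m0: "0 \<le> m \<tau> x" for \<tau> x
    unfolding m_def using p[of \<tau> x] by simp
  have mM: "m \<tau> x \<le> 3 * a" for \<tau> x
  proof -
    have "(p \<tau> x)^2 \<le> 1" using p[of \<tau> x] by (simp add: abs_square_le_1)
    moreover have "max 0 \<tau> * p \<tau> x \<le> 0" using p[of \<tau> x] by (simp add: mult_nonneg_nonpos)
    ultimately have "m \<tau> x \<le> 1 * (3 * a)"
      unfolding m_def using p[of \<tau> x] by (intro mult_mono) auto
    thus ?thesis by simp
  qed
  have lip: "\<bar>m \<tau> x - m \<tau> y\<bar> \<le> 15 * a * \<bar>x - y\<bar>" for \<tau> x y
  proof -
    let ?s = "max 0 \<tau>" and ?p = "p \<tau> x" and ?q = "p \<tau> y"
    have s: "?s \<ge> 0" by simp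
    have "m \<tau> x - m \<tau> y = (?p - ?q) * (3 * a * (?p + ?q) + (?s * ?p * ?p + ?s * ?p * ?q + ?s * ?q * ?q))"
      unfolding m_def by algebra
    \<comment> \<open>The linear part lies in [- 6 a, 0] and each of the three products in [0, 3 a];
      15 a = 6 a + 9 a.\<close>
    moreover have "\<bar>3 * a * (?p + ?q) + (?s * ?p * ?p + ?s * ?p * ?q + ?s * ?q * ?q)\<bar> \<le> 15 * a"
    proof -
      have A: "0 \<le> v * w" "v * w \<le> 3 * a" if "- (3 * a) \<le> v" "v \<le> 0" "- 1 \<le> w" "w \<le> 0" for v w
      proof -
        show "0 \<le> v * w" using that by (simp add: mult_nonpos_nonpos)
        have "(- v) * (- w) \<le> 3 * a * 1" by (rule mult_mono) (use that a in auto)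
        thus "v * w \<le> 3 * a" by simp
      qed
      have sp: "?s * ?p \<le> 0" "?s * ?q \<le> 0" using p[of \<tau> x] p[of \<tau> y] s
        by (auto simp: mult_nonneg_nonpos)
      note A = A[OF p(3)[of \<tau> x] sp(1) p(1,2)[of \<tau> x]] A[OF p(3)[of \<tau> x] sp(1) p(1,2)[of \<tau> y]]
        A[OF p(3)[of \<tau> y] sp(2) p(1,2)[of \<tau> y]]
      have "3 * a * (?p + ?q) \<le> 0" using p[of \<tau> x] p[of \<tau> y] a by (intro mult_nonneg_nonpos) auto
      moreover have "3 * a * (- 2) \<le> 3 * a * (?p + ?q)"
        using p[of \<tau> x] p[of \<tau> y] a by (intro mult_left_mono) auto
      ultimately show ?thesis using A a by linarith
    qed
    ultimately have "\<bar>m \<tau> x - m \<tau> y\<bar> \<le> \<bar>?p - ?q\<bar> * (15 * a)"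
      by (simp add: abs_mult mult_left_mono)
    also have "\<dots> \<le> \<bar>x - y\<bar> * (15 * a)"
      using a clamp_lipschitz by (intro mult_right_mono) (auto simp: p_def)
    finally show ?thesis by (simp add: mult_ac)
  qed
  obtain X where X_cont: "continuous_on UNIV X"
    and X: "\<And>\<tau>. \<tau> \<ge> 0 \<Longrightarrow> X \<tau> = - 1 + \<tau> * integral {0..1} (\<lambda>t. (1 - t powr \<theta>) * (c * m (\<tau> * t) (X (\<tau> * t))))"
  proof (atomize_elim, rule volterra_fixpoint[of "\<lambda>\<tau> x. c * m \<tau> x" "c * (3 * a)" "c * (15 * a)" "\<lambda>t. 1 - t powr \<theta>" "- 1"])
    show "continuous_on UNIV (\<lambda>(s, x). c * m s x)"
      unfolding m_def p_def case_prod_beta using a by (intro continuous_intros) (auto simp: max_def)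
    show "\<bar>c * m s x\<bar> \<le> c * (3 * a)" for s x
      using m0[of s x] mM[of s x] c by (simp add: abs_mult)
    show "\<bar>c * m s x - c * m s y\<bar> \<le> c * (15 * a) * \<bar>x - y\<bar>" for s x y
      using lip[of s x y] c by (simp add: abs_mult mult.assoc flip: right_diff_distrib)
    show "continuous_on {0..1} (\<lambda>t. 1 - t powr \<theta>)"
      using \<theta> by (intro continuous_intros continuous_on_powr') auto
    show "0 \<le> 1 - t powr \<theta> \<and> 1 - t powr \<theta> \<le> 1" if "t \<in> {0..1}" for t
      using that \<theta> by (simp add: powr_le1)
    show "\<exists>X. continuous_on UNIV X \<and> (\<forall>\<tau>\<ge>0. X \<tau> = - 1 + \<tau> *
        integral {0..1} (\<lambda>t. (1 - t powr \<theta>) * (c * m (\<tau> * t) (X (\<tau> * t)))))" if "continuous_on UNIV X"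
      "\<And>\<tau>. \<tau> \<ge> 0 \<Longrightarrow> X \<tau> = - 1 + \<tau> * integral {0..1} (\<lambda>t. (1 - t powr \<theta>) * (c * m (\<tau> * t) (X (\<tau> * t))))"
      for X using that by blast
  qed
  define n where "n s = c * m s (X s)" for s
  have n_cont: "continuous_on S n" for S
  proof -
    have "continuous_on UNIV n"
      unfolding n_def m_def p_def using a X_cont
      by (intro continuous_intros) (auto simp: max_def)
    thus ?thesis by (rule continuous_on_subset) auto
  qed
  have n0: "0 \<le> n s" and nM: "n s \<le> c * (3 * a)" for s
    using m0 mM c by (auto simp: n_def)
  \<comment> \<open>Splitting the kernel leaves two integrals whose integrands are free of \<tau>,
    so the fundamental theorem of calculus applies to each.\<close>
  define A where "A \<tau> = integral {0..\<tau>} n" for \<tau>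
  define B where "B \<tau> = integral {0..\<tau>} (\<lambda>s. s powr \<theta> * n s)" for \<tau>
  have sn_cont: "continuous_on S (\<lambda>s. s powr \<theta> * n s)" if "S \<subseteq> {0..}" for S
    using \<theta> that by (intro continuous_on_mult continuous_on_powr' n_cont continuous_intros) auto
  have dA: "(A has_real_derivative n \<tau>) (at \<tau>)" if "\<tau> > 0" for \<tau>
    unfolding A_def by (rule integral_at_has_real_derivative[OF n_cont that])
  have dB: "(B has_real_derivative \<tau> powr \<theta> * n \<tau>) (at \<tau>)" if "\<tau> > 0" for \<tau>
    unfolding B_def by (rule integral_at_has_real_derivative[OF sn_cont that]) simp
  have B_bound: "0 \<le> B \<tau>" "B \<tau> \<le> \<tau> powr \<theta> * (c * (3 * a)) * \<tau>" if "\<tau> > 0" for \<tau>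
  proof -
    have le: "norm (s powr \<theta> * n s) \<le> \<tau> powr \<theta> * (c * (3 * a))" if "s \<in> {0..\<tau>}" for s
      using that n0[of s] nM[of s] \<theta> unfolding real_norm_def abs_mult
      by (intro mult_mono) (auto intro!: powr_mono2)
    show "0 \<le> B \<tau>" unfolding B_def
      by (intro Henstock_Kurzweil_Integration.integral_nonneg integrable_continuous_real sn_cont) (auto simp: n0)
    show "B \<tau> \<le> \<tau> powr \<theta> * (c * (3 * a)) * \<tau>"
      using integral_bound[of 0 \<tau>, OF _ sn_cont le] that unfolding B_def by simp
  qed
  have XAB: "X \<tau> = - 1 + (A \<tau> - \<tau> powr (- \<theta>) * B \<tau>)" if \<tau>: "\<tau> > 0" for \<tau>
  proof -
    have im: "(\<lambda>x. x / \<tau>) ` {0..\<tau>} = {0..1}" using \<tau> by simp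
    let ?f = "\<lambda>s. (1 - (s / \<tau>) powr \<theta>) * n s"
    have "integral {0..1} (\<lambda>t. (1 - t powr \<theta>) * (c * m (\<tau> * t) (X (\<tau> * t)))) = integral {0..1} (\<lambda>t. ?f (\<tau> * t))"
      using \<tau> by (simp add: n_def)
    also have "\<dots> = 1 / \<tau> * integral {0..\<tau>} ?f"
      using integral_stretch_real[of \<tau> 0 \<tau> ?f] \<tau> unfolding im by simp
    also have "integral {0..\<tau>} ?f = integral {0..\<tau>} (\<lambda>s. n s - \<tau> powr (- \<theta>) * (s powr \<theta> * n s))"
      using \<tau> by (intro integral_cong) (simp add: powr_divide powr_minus_divide left_diff_distrib)
    also have "\<dots> = A \<tau> - \<tau> powr (- \<theta>) * B \<tau>"
      unfolding A_def B_def
      by (subst Henstock_Kurzweil_Integration.integral_diff)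
         (intro integrable_continuous_real n_cont continuous_on_mult continuous_on_const sn_cont, auto)+
    finally show ?thesis using X[of \<tau>] \<tau> by simp
  qed
  have X_ge: "- 1 \<le> X \<tau>" if "\<tau> \<ge> 0" for \<tau>
  proof -
    have "0 \<le> integral {0..1} (\<lambda>t. (1 - t powr \<theta>) * (c * m (\<tau> * t) (X (\<tau> * t))))"
    proof (intro Henstock_Kurzweil_Integration.integral_nonneg integrable_continuous_real)
      show "continuous_on {0..1} (\<lambda>t. (1 - t powr \<theta>) * (c * m (\<tau> * t) (X (\<tau> * t))))"
        using \<theta> by (intro continuous_on_mult continuous_on_compose2[OF n_cont[of UNIV, unfolded n_def]]
          continuous_intros continuous_on_powr') auto
      show "0 \<le> (1 - t powr \<theta>) * (c * m (\<tau> * t) (X (\<tau> * t)))" if "t \<in> {0..1}" for t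
        using that \<theta> c m0 by (intro mult_nonneg_nonneg) (auto simp: powr_le1)
    qed
    thus ?thesis using X[OF that] that by simp
  qed
  \<comment> \<open>The stable component of the orbit: it will be z' - \<mu> z, and it obeys dv/dy =
    \<nu> v + z^2 (3 a + z) where the cut-off is inactive. It is O(\<tau>^2), so the orbit leaves
    along the unstable direction.\<close>
  define v where "v \<tau> = \<mu> * \<theta> * (\<tau> powr (1 - \<theta>) * B \<tau>)" for \<tau>
  have dX: "(X has_real_derivative v \<tau> / (\<mu> * \<tau>^2)) (at \<tau>)" if \<tau>: "\<tau> > 0" for \<tau>
  proof -
    have "((\<lambda>\<tau>. - 1 + (A \<tau> - \<tau> powr (- \<theta>) * B \<tau>)) has_real_derivative
        n \<tau> - ((- \<theta>) * \<tau> powr (- \<theta> - 1) * B \<tau> + \<tau> powr (- \<theta>) * (\<tau> powr \<theta> * n \<tau>))) (at \<tau>)"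
      using \<tau> by (auto intro!: derivative_eq_intros dA dB)
    also have "n \<tau> - ((- \<theta>) * \<tau> powr (- \<theta> - 1) * B \<tau> + \<tau> powr (- \<theta>) * (\<tau> powr \<theta> * n \<tau>)) = v \<tau> / (\<mu> * \<tau>^2)"
    proof -
      have "\<tau> powr (- \<theta>) * (\<tau> powr \<theta> * n \<tau>) = n \<tau>" using \<tau> by (simp add: powr_minus)
      moreover have "\<tau> powr (1 - \<theta>) = \<tau> powr (- \<theta> - 1) * \<tau>^2"
        using powr_add[of \<tau> "- \<theta> - 1" 2] \<tau> by (simp add: algebra_simps)
      ultimately show ?thesis using \<tau> \<mu> by (simp add: v_def)
    qed
    finally show ?thesis
      by (rule has_field_derivative_transform_within[where d = \<tau>])
         (use \<tau> XAB in \<open>auto simp: dist_real_def\<close>)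
  qed
  have dv: "(v has_real_derivative (\<nu> / \<mu>) * v \<tau> / \<tau> + \<mu> * \<theta> * \<tau> * n \<tau>) (at \<tau>)" if \<tau>: "\<tau> > 0" for \<tau>
  proof -
    have "(v has_real_derivative \<mu> * \<theta> * ((1 - \<theta>) * \<tau> powr (1 - \<theta> - 1) * B \<tau> + \<tau> powr (1 - \<theta>) * (\<tau> powr \<theta> * n \<tau>))) (at \<tau>)"
      unfolding v_def using \<tau> by (auto intro!: derivative_eq_intros dB)
    also have "\<mu> * \<theta> * ((1 - \<theta>) * \<tau> powr (1 - \<theta> - 1) * B \<tau> + \<tau> powr (1 - \<theta>) * (\<tau> powr \<theta> * n \<tau>))
       = (\<nu> / \<mu>) * v \<tau> / \<tau> + \<mu> * \<theta> * \<tau> * n \<tau>"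
    proof -
      have 1: "\<tau> powr (1 - \<theta>) * (\<tau> powr \<theta> * n \<tau>) = \<tau> * n \<tau>"
        using \<tau> by (simp flip: mult.assoc powr_add)
      have 2: "\<tau> powr (1 - \<theta> - 1) = \<tau> powr (1 - \<theta>) / \<tau>"
        using \<tau> by (simp add: powr_diff powr_minus_divide)
      have 3: "\<nu> / \<mu> = 1 - \<theta>" by (simp add: \<theta>_def)
      show ?thesis unfolding 1 2 3 v_def by (simp add: algebra_simps)
    qed
    finally show ?thesis .
  qed
  define z where "z y = exp (\<mu> * y) * X (exp (\<mu> * y))" for y
  define z' where "z' y = \<mu> * z y + v (exp (\<mu> * y))" for y
  have dz: "(z has_real_derivative z' y) (at y)" for y
  proof -
    let ?e = "exp (\<mu> * y)"
    have de: "((\<lambda>y. exp (\<mu> * y)) has_real_derivative \<mu> * ?e) (at y)"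
      by (auto intro!: derivative_eq_intros)
    have "(z has_real_derivative \<mu> * ?e * X ?e + v ?e / (\<mu> * ?e^2) * (\<mu> * ?e) * ?e) (at y)"
      unfolding z_def by (rule DERIV_mult[OF de DERIV_chain2[OF dX de]]) simp
    thus ?thesis using \<mu> by (simp add: z'_def z_def power2_eq_square mult.assoc)
  qed
  have dz': "(z' has_real_derivative \<gamma> * z y + 3 * a * (z y)^2 + (z y)^3 - \<alpha> * z' y) (at y)"
    if "- (3 * a) \<le> z y" "z y \<le> 0" for y
  proof -
    let ?e = "exp (\<mu> * y)"
    have de: "((\<lambda>y. exp (\<mu> * y)) has_real_derivative \<mu> * ?e) (at y)"
      by (auto intro!: derivative_eq_intros)
    have "(z' has_real_derivative \<mu> * z' y + ((\<nu> / \<mu>) * v ?e / ?e + \<mu> * \<theta> * ?e * n ?e) * (\<mu> * ?e)) (at y)"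
      unfolding z'_def[abs_def]
      by (rule DERIV_add[OF DERIV_cmult[OF dz, unfolded z'_def] DERIV_chain2[OF dv de]]) simp
    also have "\<mu> * z' y + ((\<nu> / \<mu>) * v ?e / ?e + \<mu> * \<theta> * ?e * n ?e) * (\<mu> * ?e) =
       \<gamma> * z y + 3 * a * (z y)^2 + (z y)^3 - \<alpha> * z' y"
    proof -
      have "X ?e \<le> 0" using that(2) by (simp add: z_def mult_le_0_iff)
      moreover have "- 1 \<le> X ?e" by (rule X_ge) simp
      moreover have "- (3 * a / ?e) \<le> X ?e" using that(1) by (simp add: z_def field_simps)
      ultimately have "p ?e (X ?e) = X ?e" using a by (auto simp: p_def max_def)
      hence "n ?e = c * ((X ?e)^2 * (3 * a + ?e * X ?e))" by (simp add: n_def m_def max_def)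
      hence "?e^2 * n ?e = c * (3 * a * (z y)^2 + (z y)^3)"
        by (simp add: z_def algebra_simps power2_eq_square power3_eq_cube)
      moreover have "((\<nu> / \<mu>) * v ?e / ?e + \<mu> * \<theta> * ?e * n ?e) * (\<mu> * ?e) = \<nu> * v ?e + \<mu>^2 * \<theta> * (?e^2 * n ?e)"
        using \<mu> by (simp add: algebra_simps power2_eq_square)
      moreover have "\<mu>^2 * \<theta> * c = 1" using \<mu> \<theta> by (simp add: c_def)
      moreover have "\<nu> * v ?e = \<nu> * z' y + \<gamma> * z y"
        using prod unfolding z'_def by algebra
      moreover have "\<mu> * z' y = - \<alpha> * z' y - \<nu> * z' y" using sum by algebra
      ultimately show ?thesis by algebra
    qed
    finally show ?thesis .
  qed
  have e0: "((\<lambda>y. exp (\<mu> * y)) \<longlongrightarrow> 0) at_bot"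
    using \<mu> by (intro filterlim_compose[OF exp_at_bot] filterlim_tendsto_pos_mult_at_bot[OF tendsto_const]) (auto simp: filterlim_ident)
  have X0: "((\<lambda>y. X (exp (\<mu> * y))) \<longlongrightarrow> - 1) at_bot"
  proof -
    have "isCont X 0" using X_cont by (simp add: continuous_on_eq_continuous_at)
    moreover have "X 0 = - 1" by (subst X) simp_all
    ultimately show ?thesis using isCont_tendsto_compose[of 0 X, OF _ e0] by metis
  qed
  have z0: "(z \<longlongrightarrow> 0) at_bot" unfolding z_def using tendsto_mult[OF e0 X0] by simp
  have v_bound: "norm (v \<tau>) \<le> \<mu> * \<theta> * (c * (3 * a)) * \<tau>^2" if \<tau>: "\<tau> > 0" for \<tau>
  proof -
    have "v \<tau> \<le> \<mu> * \<theta> * (\<tau> powr (1 - \<theta>) * (\<tau> powr \<theta> * (c * (3 * a)) * \<tau>))"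
      unfolding v_def using B_bound[OF \<tau>] \<mu> \<theta> by (intro mult_left_mono) auto
    also have "\<dots> = \<mu> * \<theta> * (c * (3 * a)) * \<tau> * (\<tau> powr (1 - \<theta>) * \<tau> powr \<theta>)" by simp
    also have "\<tau> powr (1 - \<theta>) * \<tau> powr \<theta> = \<tau>" using \<tau> by (simp flip: powr_add)
    finally have "v \<tau> \<le> \<mu> * \<theta> * (c * (3 * a)) * \<tau>^2" by (simp add: power2_eq_square mult.assoc)
    moreover have "0 \<le> v \<tau>" unfolding v_def using B_bound[OF \<tau>] \<mu> \<theta> by simp
    ultimately show ?thesis by simp
  qed
  have v0: "((\<lambda>y. v (exp (\<mu> * y))) \<longlongrightarrow> 0) at_bot"
  proof (rule Lim_null_comparison)
    show "eventually (\<lambda>y. norm (v (exp (\<mu> * y))) \<le> \<mu> * \<theta> * (c * (3 * a)) * exp (\<mu> * y)^2) at_bot"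
      using v_bound by simp
    show "((\<lambda>y. \<mu> * \<theta> * (c * (3 * a)) * exp (\<mu> * y)^2) \<longlongrightarrow> 0) at_bot"
      using tendsto_mult[OF tendsto_const tendsto_power[OF e0], of "\<mu> * \<theta> * (c * (3 * a))" 2] by simp
  qed
  show ?thesis
  proof (rule that[OF dz dz' z0])
    show "(z' \<longlongrightarrow> 0) at_bot" unfolding z'_def using tendsto_add[OF tendsto_mult[OF tendsto_const z0] v0] by simp
    have "eventually (\<lambda>y. X (exp (\<mu> * y)) < 0) at_bot" using order_tendstoD(2)[OF X0] by simp
    thus "eventually (\<lambda>y. z y < 0) at_bot" by eventually_elim (simp add: z_def mult_less_0_iff)
  qed
qed

section \<open>Orbits of the cubic travelling-wave equation\<close>

locale cubic =
  fixes \<alpha> k a q r :: real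
  assumes \<alpha>: "\<alpha> > 0" and k: "k > 0" "2 * k^2 = 1"
    and roots: "q \<le> r" "r < a" "a + q + r = 0"
begin

definition g where "g x = (x - a) * (x - q) * (x - r)"
text \<open>An antiderivative of \<open>g\<close>, by Vieta's formulas; there is no x^3 term because
  the roots sum to 0.\<close>

definition G where "G x = x^4 / 4 + (a * q + a * r + q * r) * x^2 / 2 - a * q * r * x"
text \<open>The parabola p = k (x - a) (x - q) is an orbit curve if k^2 (2 x - a - q) = (x - r) - k
  \<alpha>. With 2 k^2 = 1 and r = - a - q the terms in x cancel, and \<open>excess\<close> is the
  right side minus the left side.\<close>

definition excess where "excess = 3 / 2 * (a + q) - k * \<alpha>"

lemma r_eq: "r = - a - q" using roots(3) by simp

lemma q_less_a: "q < a" using roots by simp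

lemma a_pos: "a > 0" using roots by simp

lemma G_deriv: "(G has_real_derivative g x) (at x)"
proof -
  have "(G has_real_derivative x^3 + (a * q + a * r + q * r) * x - a * q * r) (at x)"
    unfolding G_def[abs_def] by (auto intro!: derivative_eq_intros simp: power2_eq_square power3_eq_cube)
  moreover have "x^3 + (a * q + a * r + q * r) * x - a * q * r = g x"
    using r_eq unfolding g_def by algebra
  ultimately show ?thesis by simp
qed

lemma G_cont: "continuous_on S G"
  unfolding G_def[abs_def] by (intro continuous_intros) auto

lemma g_cont: "continuous_on S g"
  unfolding g_def[abs_def] by (intro continuous_intros)

lemma tendsto_G: "(f \<longlongrightarrow> l) F \<Longrightarrow> ((\<lambda>y. G (f y)) \<longlongrightarrow> G l) F"
  unfolding G_def by (intro tendsto_intros) auto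

lemma tendsto_g: "(f \<longlongrightarrow> l) F \<Longrightarrow> ((\<lambda>y. g (f y)) \<longlongrightarrow> g l) F"
  unfolding g_def by (intro tendsto_intros)

end

text \<open>The set \<open>I\<close> is a left half-line or the whole line: the half-line case is needed because the orbit
  built above solves the travelling-wave equation only until it first leaves \<open>[q, a]\<close>.\<close>

locale orbit = cubic +
  fixes u p :: "real \<Rightarrow> real" and I :: "real set"
  assumes du: "\<And>y. (u has_real_derivative p y) (at y)"
    and dp: "\<And>y. y \<in> I \<Longrightarrow> (p has_real_derivative g (u y) - \<alpha> * p y) (at y)"
    and I_down: "\<And>x y. y \<in> I \<Longrightarrow> x \<le> y \<Longrightarrow> x \<in> I"
    and u_bot: "(u \<longlongrightarrow> a) at_bot" and p_bot: "(p \<longlongrightarrow> 0) at_bot"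
begin

definition H where "H y = (p y)^2 / 2 - G (u y)"
definition w where "w y = p y - k * (u y - a) * (u y - q)"

lemma u_cont: "continuous_on S u"
  by (rule DERIV_continuous_on) (auto intro: has_field_derivative_at_within du)

lemma dH: "y \<in> I \<Longrightarrow> (H has_real_derivative - \<alpha> * (p y)^2) (at y)"
  unfolding H_def[abs_def]
  by (auto intro!: derivative_eq_intros DERIV_chain2[OF G_deriv] du dp simp: field_simps power2_eq_square)

lemma H_bot: "(H \<longlongrightarrow> - G a) at_bot"
proof -
  have "(H \<longlongrightarrow> 0^2 / 2 - G a) at_bot"
    unfolding H_def by (intro tendsto_intros tendsto_G u_bot p_bot) auto
  thus ?thesis by simp
qed

lemma H_le: "T \<in> I \<Longrightarrow> H T \<le> - G a"
  by (rule nonincreasing_le_limit_at_bot[OF dH _ H_bot]) (use I_down \<alpha> in auto)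

lemma H_mono: "T \<in> I \<Longrightarrow> y \<le> T \<Longrightarrow> H T \<le> H y"
  by (rule DERIV_nonpos_imp_nonincreasing) (use dH I_down \<alpha> in \<open>auto intro!: exI\<close>)

text \<open>H decreases from its limit - G a at -infinity. Having the value - G a still at T leaves
  no dissipation before T, so p vanishes there and u keeps its limit value.\<close>

lemma energy_eq_imp_rest:
  assumes T: "T \<in> I" and HT: "H T \<ge> - G a" and y: "y \<le> T"
  shows "u y = a"
proof -
  have H: "H x = - G a" if "x \<le> T" for x
    using H_le[OF I_down[OF T that]] H_mono[OF T that] HT by simp
  have p: "p x = 0" if x: "x < T" for x
  proof -
    have "- \<alpha> * (p x)^2 = 0"
    proof (rule DERIV_local_max)
      show "(H has_real_derivative - \<alpha> * (p x)^2) (at x)" using dH I_down[OF T] x by simp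
      show "\<forall>y. \<bar>x - y\<bar> < T - x \<longrightarrow> H y \<le> H x" using H x by auto
    qed (use x in simp)
    thus ?thesis using \<alpha> by simp
  qed
  have "u y \<le> a"
    by (rule nonincreasing_le_limit_at_bot[OF du _ u_bot]) (use p y in auto)
  moreover have "- u y \<le> - a"
    by (rule nonincreasing_le_limit_at_bot[OF DERIV_minus[OF du] _ tendsto_minus[OF u_bot]]) (use p y in auto)
  ultimately show ?thesis by simp
qed

lemma at_a_imp_rest:
  assumes "T \<in> I" "u T = a" "y \<le> T"
  shows "u y = a"
  by (rule energy_eq_imp_rest[OF assms(1) _ assms(3)]) (simp add: H_def assms(2))

section \<open>The defect from the parabola\<close>

lemma w_bot: "(w \<longlongrightarrow> 0) at_bot"
proof -
  have "(w \<longlongrightarrow> 0 - k * (a - a) * (a - q)) at_bot"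
    unfolding w_def by (intro tendsto_intros u_bot p_bot)
  thus ?thesis by simp
qed

lemma dw:
  assumes "y \<in> I"
  shows "(w has_real_derivative
    excess * ((u y - a) * (u y - q)) - (\<alpha> + k * (2 * u y - a - q)) * w y) (at y)"
proof -
  have "(w has_real_derivative g (u y) - \<alpha> * p y - (k * p y * (u y - q) + p y * (k * (u y - a)))) (at y)"
    unfolding w_def[abs_def] by (auto intro!: derivative_eq_intros du dp assms)
  moreover have "g (u y) - \<alpha> * p y - (k * p y * (u y - q) + p y * (k * (u y - a))) =
    excess * ((u y - a) * (u y - q)) - (\<alpha> + k * (2 * u y - a - q)) * w y"
  proof -
    \<comment> \<open>Doubling turns 2 k^2 = 1 and the coefficient 3/2 in \<open>excess\<close> into
      relations with integer coefficients, which \<open>algebra\<close> can use.\<close>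
    have "2 * (g (u y) - \<alpha> * p y - (k * p y * (u y - q) + p y * (k * (u y - a)))) =
      2 * (excess * ((u y - a) * (u y - q)) - (\<alpha> + k * (2 * u y - a - q)) * w y)"
    proof -
      have e: "2 * excess = 3 * (a + q) - 2 * k * \<alpha>" by (simp add: excess_def)
      show ?thesis using e k(2) r_eq unfolding g_def w_def by algebra
    qed
    thus ?thesis by simp
  qed
  ultimately show ?thesis by simp
qed

text \<open>The integrating factor \<open>E\<close> stays bounded at \<open>-\<infinity>\<close> since \<open>c\<close> tends to \<open>\<alpha> + k (a - q) > 0\<close> there.\<close>

definition c where "c y = \<alpha> + k * (2 * u y - a - q)"
definition F where "F = (SOME F. \<forall>y. (F has_real_derivative c y) (at y))"
definition E where "E y = exp (F y)"

lemma F_deriv: "(F has_real_derivative c y) (at y)"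
proof -
  have "\<And>x. isCont c x" unfolding c_def
    by (intro continuous_intros) (use u_cont[of UNIV] in \<open>auto simp: continuous_on_eq_continuous_at\<close>)
  with einterval_antiderivative[of "-\<infinity>" \<infinity> c]
  have "\<exists>F. \<forall>y. (F has_real_derivative c y) (at y)"
    by (simp add: has_real_derivative_iff_has_vector_derivative)
  from someI_ex[OF this] show ?thesis unfolding F_def by blast
qed

lemma E_pos: "E y > 0" by (simp add: E_def)

lemma dE: "(E has_real_derivative c y * E y) (at y)"
  unfolding E_def[abs_def] by (auto intro!: derivative_eq_intros F_deriv)

lemma dwE:
  assumes "y \<in> I"
  shows "((\<lambda>y. w y * E y) has_real_derivative excess * ((u y - a) * (u y - q)) * E y) (at y)"
  using DERIV_mult[OF dw[OF assms] dE] by (simp add: c_def algebra_simps)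

lemma wE_bot: "((\<lambda>y. w y * E y) \<longlongrightarrow> 0) at_bot"
proof -
  have "(c \<longlongrightarrow> \<alpha> + k * (2 * a - a - q)) at_bot"
    unfolding c_def by (intro tendsto_intros u_bot)
  moreover have "\<alpha> + k * (2 * a - a - q) > 0"
    using \<alpha> mult_pos_pos[OF k(1), of "a - q"] q_less_a by simp
  ultimately have "eventually (\<lambda>y. c y > 0) at_bot" by (rule order_tendstoD)
  then obtain N where N: "\<And>y. y \<le> N \<Longrightarrow> c y > 0" by (auto simp: eventually_at_bot_linorder)
  have bound: "E y \<le> E N" if "y \<le> N" for y
  proof (rule DERIV_nonneg_imp_nondecreasing[OF that])
    show "\<exists>d. (E has_real_derivative d) (at x) \<and> d \<ge> 0" if "x \<le> N" for x
      using dE[of x] mult_pos_pos[OF N[OF that] E_pos[of x]] by (auto intro: less_imp_le)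
  qed
  show ?thesis
  proof (rule Lim_null_comparison)
    show "eventually (\<lambda>y. norm (w y * E y) \<le> \<bar>w y\<bar> * E N) at_bot"
      by (rule eventually_mono[OF eventually_le_at_bot[of N]])
         (use bound E_pos in \<open>auto simp: abs_mult abs_of_pos intro!: mult_left_mono\<close>)
    show "((\<lambda>y. \<bar>w y\<bar> * E N) \<longlongrightarrow> 0) at_bot"
      using tendsto_mult_right[OF tendsto_rabs[OF w_bot], of "E N"] by simp
  qed
qed

text \<open>In the strip (u - a) (u - q) is negative, so w E increases strictly from its limit 0 at
  -infinity; \<open>w_neg\<close> is the mirror case.\<close>

lemma w_pos:
  assumes T: "T \<in> I" and u: "\<And>y. y < T \<Longrightarrow> q < u y \<and> u y < a" and "excess < 0"
  shows "w T > 0"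
proof -
  have "- (w T * E T) < - 0"
  proof (rule decreasing_less_limit_at_bot[OF DERIV_minus[OF dwE] _ tendsto_minus[OF wE_bot]])
    show "y \<in> I" if "y \<le> T" for y using I_down[OF T that] .
    show "- (excess * ((u y - a) * (u y - q)) * E y) < 0" if "y < T" for y
      using u[OF that] assms(3) E_pos[of y] by (simp add: mult_neg_neg mult_neg_pos)
  qed
  thus ?thesis using E_pos[of T] by (simp add: zero_less_mult_iff)
qed

lemma w_neg:
  assumes T: "T \<in> I" and u: "\<And>y. y < T \<Longrightarrow> q < u y \<and> u y < a" and "excess > 0"
  shows "w T < 0"
proof -
  have "w T * E T < 0"
  proof (rule decreasing_less_limit_at_bot[OF dwE _ wE_bot])
    show "y \<in> I" if "y \<le> T" for y using I_down[OF T that] .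
    show "excess * ((u y - a) * (u y - q)) * E y < 0" if "y < T" for y
      using u[OF that] assms(3) E_pos[of y] by (simp add: mult_neg_pos mult_pos_neg)
  qed
  thus ?thesis using E_pos[of T] by (simp add: mult_less_0_iff not_less_iff_gr_or_eq)
qed

lemma w_zero:
  assumes T: "T \<in> I" and "excess = 0"
  shows "w T = 0"
proof -
  have "w T * E T \<le> 0"
    by (rule nonincreasing_le_limit_at_bot[OF dwE _ wE_bot]) (use I_down[OF T] assms(2) in auto)
  moreover have "- (w T * E T) \<le> - 0"
    by (rule nonincreasing_le_limit_at_bot[OF DERIV_minus[OF dwE] _ tendsto_minus[OF wE_bot]])
       (use I_down[OF T] assms(2) in auto)
  ultimately have "w T * E T = 0" by simp
  thus ?thesis using E_pos[of T] by simp
qed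

text \<open>On a first arrival at q from above the slope p is \<le> 0. The parabola vanishes at q,
  so w = p there, against w > 0.\<close>

lemma not_hit_q_if_excess_neg:
  assumes T: "T \<in> I" and u: "\<And>y. y < T \<Longrightarrow> q < u y \<and> u y < a" and "excess < 0"
  shows "u T \<noteq> q"
proof
  assume uT: "u T = q"
  have "p T \<le> 0"
    by (rule deriv_nonpos_if_left_ge[OF du, of "T - 1"]) (use u uT in \<open>auto intro: less_imp_le\<close>)
  moreover have "w T = p T" using uT by (simp add: w_def)
  ultimately show False using w_pos[OF assms] by simp
qed

end

section \<open>Orbits on the whole line: long-time behaviour by the sign of
  \<open>excess\<close>\<close>

locale global_orbit = orbit \<alpha> k a q r u p UNIV for \<alpha> k a q r u p
begin

lemma p_cont: "continuous_on S p"
  by (rule DERIV_continuous_on) (auto intro: has_field_derivative_at_within dp)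

text \<open>A Gronwall argument for \<open>(u - a)\<^sup>2 + p\<^sup>2\<close>.\<close>

lemma rest_unique:
  assumes "u T = a" "p T = 0" "T \<le> y"
  shows "u y = a"
proof -
  define h where "h x = (u x - q) * (u x - r)" for x
  have "continuous_on {T..y} h" unfolding h_def by (intro continuous_intros u_cont)
  hence "bounded (h ` {T..y})" by (intro compact_imp_bounded compact_continuous_image) auto
  then obtain M where "\<forall>x\<in>{T..y}. \<bar>h x\<bar> \<le> M" by (auto simp: bounded_iff)
  hence M: "\<bar>h x\<bar> \<le> M" if "x \<in> {T..y}" for x using that by blast
  define V where "V x = (u x - a)^2 + (p x)^2" for x
  define V' where "V' x = 2 * (u x - a) * p x + 2 * p x * ((u x - a) * h x - \<alpha> * p x)" for x
  have dV: "(V has_real_derivative V' x) (at x)" for x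
    unfolding V_def[abs_def] V'_def
    by (auto intro!: derivative_eq_intros du dp simp: g_def h_def algebra_simps)
  have le: "V' x \<le> (1 + M) * V x" if "x \<in> {T..y}" for x
  proof -
    have "\<bar>2 * (u x - a) * p x\<bar> \<le> V x"
      using zero_le_power2[of "(u x - a) - p x"] zero_le_power2[of "(u x - a) + p x"]
      unfolding V_def abs_le_iff by (auto simp: power2_eq_square algebra_simps)
    hence "\<bar>2 * (u x - a) * p x\<bar> * \<bar>1 + h x\<bar> \<le> V x * (1 + M)"
      using M[OF that] by (intro mult_mono) (auto simp: V_def)
    moreover have "V' x = 2 * (u x - a) * p x * (1 + h x) - 2 * \<alpha> * (p x)^2"
      unfolding V'_def by algebra
    moreover have "0 \<le> 2 * \<alpha> * (p x)^2" using \<alpha> by simp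
    ultimately show ?thesis
      using abs_ge_self[of "2 * (u x - a) * p x * (1 + h x)"] by (simp add: abs_mult mult.commute)
  qed
  let ?W = "\<lambda>x. V x * exp (- (1 + M) * x)"
  have "?W y \<le> ?W T"
  proof (rule DERIV_nonpos_imp_nonincreasing[OF assms(3)])
    fix x assume x: "T \<le> x" "x \<le> y"
    have "(?W has_real_derivative (V' x - (1 + M) * V x) * exp (- (1 + M) * x)) (at x)"
      by (auto intro!: derivative_eq_intros dV simp: algebra_simps)
    moreover have "(V' x - (1 + M) * V x) * exp (- (1 + M) * x) \<le> 0"
      using le[of x] x by (intro mult_nonpos_nonneg) auto
    ultimately show "\<exists>d. (?W has_real_derivative d) (at x) \<and> d \<le> 0" by blast
  qed
  also have "?W T = 0" using assms by (simp add: V_def)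
  finally have "V y \<le> 0" by (simp add: mult_le_0_iff)
  thus ?thesis unfolding V_def
    by (metis add_nonneg_nonneg add_nonneg_eq_0_iff antisym eq_iff_diff_eq_0 zero_eq_power2 zero_le_power2)
qed

text \<open>Otherwise u passes a at some T on its way to l. There the energy bound H T \<le> - G a
  forces p T = 0, and uniqueness of the rest state keeps u at a from then on.\<close>

lemma below_a:
  assumes lim: "(u \<longlongrightarrow> l) at_top" and l: "l < a"
  shows "u y < a"
proof (rule ccontr)
  assume "\<not> u y < a"
  hence y: "u y \<ge> a" by simp
  have "eventually (\<lambda>x. u x < a \<and> x \<ge> y) at_top"
    by (intro eventually_conj order_tendstoD(2)[OF lim l] eventually_ge_at_top)
  then obtain x where x: "u x < a" "x \<ge> y" by (auto simp: eventually_at_top_linorder)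
  obtain T where T: "u T = a" using IVT2'[of u x a y] x y u_cont by auto
  have "p T = 0"
    using H_le[of T] by (simp add: H_def T)
  hence "u x = a" if "x \<ge> T" for x using rest_unique[OF T] that by blast
  hence "eventually (\<lambda>x. u x = a) at_top" by (auto simp: eventually_at_top_linorder)
  hence "(u \<longlongrightarrow> a) at_top" by (rule tendsto_eventually)
  from tendsto_unique[OF _ this lim] l show False by simp
qed

text \<open>While u stays above q the orbit lies under the parabola. At r > q the parabola is
  negative, so p could not tend to 0; convergence to q is excluded by the integrating factor. Once u
  is below q, all three factors of g are negative and p cannot climb back to 0.\<close>

lemma excess_pos_no_limit:
  assumes lim: "(u \<longlongrightarrow> l) at_top" "(p \<longlongrightarrow> 0) at_top" and l: "l = q \<or> l = r" and ex: "excess > 0"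
  shows False
proof (cases "\<forall>y. q < u y")
  case True
  have la: "l < a" using l roots by auto
  have u: "q < u y \<and> u y < a" for y using True below_a[OF lim(1) la] by blast
  have w: "w y < 0" for y by (rule w_neg) (use u ex in auto)
  have w_top: "(w \<longlongrightarrow> 0 - k * (l - a) * (l - q)) at_top"
    unfolding w_def by (intro tendsto_intros lim)
  show False
  proof (cases "l = q")
    case False
    hence "0 < 0 - k * (l - a) * (l - q)"
      using l k la roots by (simp add: mult_less_0_iff zero_less_mult_iff)
    moreover have "0 - k * (l - a) * (l - q) \<le> 0"
      by (rule tendsto_upperbound[OF w_top]) (use w in \<open>auto intro: always_eventually less_imp_le\<close>)
    ultimately show False by simp
  next
    case True
      have "(c \<longlongrightarrow> \<alpha> + k * (2 * q - a - q)) at_top"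
      unfolding c_def using lim(1) True by (intro tendsto_intros) auto
    \<comment> \<open>Since \<open>excess\<close> > 0, k times this quantity is less than a + 2 q =
      q - r, which is \<le> 0.\<close>
    moreover have "\<alpha> + k * (2 * q - a - q) < 0"
    proof -
      have "k * (\<alpha> + k * (2 * q - a - q)) = k * \<alpha> + (2 * k^2) * (q - a) / 2"
        by (simp add: field_simps power2_eq_square)
      also have "\<dots> < 0" using ex roots unfolding k(2) excess_def by (simp add: r_eq field_simps)
      finally show ?thesis using k(1) by (simp add: mult_less_0_iff)
    qed
    ultimately have "eventually (\<lambda>y. c y < 0) at_top" by (rule order_tendstoD)
    then obtain N where N: "\<And>y. y \<ge> N \<Longrightarrow> c y < 0"
      by (auto simp: eventually_at_top_linorder)
    have bound: "E y \<le> E N" if "y \<ge> N" for y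
    proof (rule DERIV_nonpos_imp_nonincreasing[OF that])
      show "\<exists>d. (E has_real_derivative d) (at x) \<and> d \<le> 0" if "N \<le> x" for x
        using dE[of x] mult_neg_pos[OF N[OF that] E_pos[of x]] by (auto intro: less_imp_le)
    qed
    \<comment> \<open>The coefficient \<open>c\<close> is eventually negative, so \<open>E\<close> is bounded at \<open>+\<infinity>\<close> too, while \<open>w E\<close> is negative and nonincreasing.\<close>
    have "((\<lambda>y. w y * E y) \<longlongrightarrow> 0) at_top"
    proof (rule Lim_null_comparison)
      show "eventually (\<lambda>y. norm (w y * E y) \<le> \<bar>w y\<bar> * E N) at_top"
        by (rule eventually_mono[OF eventually_ge_at_top[of N]])
           (use bound E_pos in \<open>auto simp: abs_mult abs_of_pos intro!: mult_left_mono\<close>)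
      show "((\<lambda>y. \<bar>w y\<bar> * E N) \<longlongrightarrow> 0) at_top"
        using tendsto_mult_right[OF tendsto_rabs[OF w_top], of "E N"] True by simp
    qed
    hence "0 \<le> w 0 * E 0"
    proof (rule limit_at_top_le_nonincreasing[OF dwE, rotated 2])
      show "excess * ((u y - a) * (u y - q)) * E y \<le> 0" for y
        using mult_neg_pos[of "u y - a" "u y - q"] u[of y] ex E_pos[of y]
        by (intro mult_nonpos_nonneg mult_nonneg_nonpos) auto
    qed simp
    thus False using w[of 0] E_pos[of 0] by (simp add: zero_le_mult_iff)
  qed
next
  case False
  have la: "l < a" using l roots by auto
  obtain b where b: "u b - q \<le> 0" using False by (auto simp: not_less)
  have "\<exists>T. u T - q = 0 \<and> (\<forall>y<T. u y - q > 0)"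
  proof (rule first_hitting_time[where f = "\<lambda>y. u y - q"])
    show "continuous_on UNIV (\<lambda>y. u y - q)" by (intro continuous_intros u_cont)
    show "eventually (\<lambda>y. u y - q > 0) at_bot"
      using order_tendstoD(1)[OF u_bot q_less_a] by simp
  qed (rule b)
  then obtain T where T: "u T - q = 0" "\<And>y. y < T \<Longrightarrow> u y - q > 0" by blast
  have "w T < 0" by (rule w_neg) (use T below_a[OF lim(1) la] ex in auto)
  hence pT: "p T < 0" using T(1) by (simp add: w_def)
  have p: "p y < 0" if yT: "y \<ge> T" for y
  proof (rule ccontr)
    assume "\<not> p y < 0"
    \<comment> \<open>Freezing p at the value p T for x \<le> T supplies the sign near -infinity, so
      the hitting-time lemma yields the first zero after T.\<close>
    have "\<exists>t. - p (max t T) = 0 \<and> (\<forall>x<t. - p (max x T) > 0)"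
    proof (rule first_hitting_time[where f = "\<lambda>x. - p (max x T)" and b = y])
      show "continuous_on UNIV (\<lambda>x. - p (max x T))"
        by (intro continuous_intros continuous_on_compose2[OF p_cont[of UNIV]]) auto
      show "eventually (\<lambda>x. - p (max x T) > 0) at_bot"
        using pT by (intro eventually_mono[OF eventually_le_at_bot[of T]]) (auto simp: max_def)
      show "- p (max y T) \<le> 0" using \<open>\<not> p y < 0\<close> yT by (simp add: max_absorb1)
    qed
    then obtain t where t: "- p (max t T) = 0" "\<And>x. x < t \<Longrightarrow> - p (max x T) > 0" by blast
    have tT: "t > T" using t(1) pT by (cases "t \<le> T") (auto simp: max_def)
    have pt: "p t = 0" using t(1) tT by simp
    have px: "p x < 0" if "T \<le> x" "x < t" for x using t(2)[OF that(2)] that by (simp add: max_def)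
    have "u t < u T"
      by (rule DERIV_neg_imp_decreasing_open[OF tT _ u_cont]) (use du px in \<open>force\<close>)
    hence "u t < q" using T by simp
    hence "g (u t) < 0" unfolding g_def using roots by (intro mult_pos_neg mult_neg_neg) auto
    moreover have "- (g (u t) - \<alpha> * p t) \<le> 0"
      by (rule deriv_nonpos_if_left_ge[OF DERIV_minus[OF dp] tT]) (use px pt in \<open>auto intro: less_imp_le\<close>)
    ultimately show False using pt by simp
  qed
  have "u (T + 1) < u T"
    by (rule DERIV_neg_imp_decreasing_open[OF _ _ u_cont]) (use du p in \<open>force\<close>)+
  moreover have "l \<le> u (T + 1)"
    by (rule limit_at_top_le_nonincreasing[OF du _ lim(1)]) (use p in \<open>auto intro: less_imp_le\<close>)
  ultimately show False using T(1) l roots by auto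
qed

text \<open>With w = 0 the orbit runs on the parabola, whose only zeros are a and q.\<close>

lemma excess_zero_limit:
  assumes lim: "(u \<longlongrightarrow> l) at_top" "(p \<longlongrightarrow> 0) at_top" and l: "l < a" and ex: "excess = 0"
  shows "l = q"
proof -
  have "(w \<longlongrightarrow> 0 - k * (l - a) * (l - q)) at_top"
    unfolding w_def by (intro tendsto_intros lim)
  moreover have "w = (\<lambda>_. 0)" using w_zero[OF _ ex] by auto
  ultimately have "0 - k * (l - a) * (l - q) = 0" by (simp add: tendsto_const_iff)
  thus ?thesis using k l by simp
qed

lemma excess_neg_above_q:
  assumes u: "\<And>y. u y < a" and ex: "excess < 0"
  shows "u y > q"
proof (rule ccontr)
  assume b: "\<not> u y > q"
  have "\<exists>T. u T - q = 0 \<and> (\<forall>y<T. u y - q > 0)"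
  proof (rule first_hitting_time[where f = "\<lambda>y. u y - q" and b = y])
    show "continuous_on UNIV (\<lambda>y. u y - q)" by (intro continuous_intros u_cont)
    show "eventually (\<lambda>y. u y - q > 0) at_bot"
      using order_tendstoD(1)[OF u_bot q_less_a] by simp
  qed (use b in auto)
  then obtain T where T: "u T - q = 0" "\<And>y. y < T \<Longrightarrow> u y - q > 0" by blast
  show False using not_hit_q_if_excess_neg[of T] T u ex by auto
qed

text \<open>The slope \<open>m = min (k (q - a)) (- \<alpha>)\<close> is chosen so that \<open>D = p - m (u - q)\<close> is positive along the
  orbit and eventually nondecreasing, which contradicts \<open>D \<rightarrow> 0\<close>.\<close>

lemma excess_neg_no_limit_q:
  assumes lim: "(u \<longlongrightarrow> q) at_top" "(p \<longlongrightarrow> 0) at_top" and qr: "q < r" and ex: "excess < 0"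
  shows False
proof -
  have ua: "u y < a" for y by (rule below_a[OF lim(1) q_less_a])
  have uq: "q < u y" for y by (rule excess_neg_above_q[OF ua ex])
  have w: "w y > 0" for y by (rule w_pos) (use uq ua ex in auto)
  \<comment> \<open>The slope of the parabola at q. By convexity p stays above this tangent line,
    hence for u > q above every line through (q, 0) of smaller slope. The bound by - \<alpha> fixes
    the sign of - (\<alpha> + m) D.\<close>
  define \<kappa> where "\<kappa> = k * (q - a)"
  define m where "m = min \<kappa> (- \<alpha>)"
  have m_neg: "\<alpha> + m \<le> 0" by (simp add: m_def)
  define D where "D y = p y - m * (u y - q)" for y
  have D: "D y > 0" for y
  proof -
    have "\<kappa> * (u y - q) \<le> k * (u y - a) * (u y - q)"
      unfolding \<kappa>_def using k uq[of y] by (intro mult_right_mono mult_left_mono) auto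
    moreover have "m * (u y - q) \<le> \<kappa> * (u y - q)"
      using uq[of y] by (intro mult_right_mono) (auto simp: m_def)
    ultimately show ?thesis using w[of y] by (simp add: D_def w_def)
  qed
  define e where "e y = (u y - a) * (u y - r) - (\<alpha> + m) * m" for y
  have dD: "(D has_real_derivative - (\<alpha> + m) * D y + (u y - q) * e y) (at y)" for y
  proof -
    have "(D has_real_derivative g (u y) - \<alpha> * p y - m * p y) (at y)"
      unfolding D_def[abs_def] by (auto intro!: derivative_eq_intros du dp)
    moreover have "g (u y) - \<alpha> * p y - m * p y = - (\<alpha> + m) * D y + (u y - q) * e y"
      unfolding g_def D_def e_def by algebra
    ultimately show ?thesis by simp
  qed
  have "(e \<longlongrightarrow> (q - a) * (q - r) - (\<alpha> + m) * m) at_top"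
    unfolding e_def by (intro tendsto_intros lim)
  \<comment> \<open>For m = - \<alpha> the sign comes from q < r; for m = \<open>\<kappa>\<close>
    the expression equals (q - a) times \<open>excess\<close>.\<close>
  moreover have "(q - a) * (q - r) - (\<alpha> + m) * m > 0"
  proof (cases "m = - \<alpha>")
    case True thus ?thesis using q_less_a qr by (simp add: mult_neg_neg)
  next
    case False
    hence m: "m = k * (q - a)" by (auto simp: m_def \<kappa>_def min_def split: if_splits)
    have "2 * ((q - a) * (q - r) - (\<alpha> + m) * m) = 2 * ((q - a) * excess)"
      using k(2) unfolding m excess_def r_eq by (simp add: field_simps) algebra
    moreover have "(q - a) * excess > 0" using ex q_less_a by (simp add: mult_neg_neg)
    ultimately show ?thesis by simp
  qed
  ultimately have "eventually (\<lambda>y. e y > 0) at_top" by (rule order_tendstoD)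
  then obtain N where N: "\<And>y. y \<ge> N \<Longrightarrow> e y > 0" by (auto simp: eventually_at_top_linorder)
  have "(D \<longlongrightarrow> 0 - m * (q - q)) at_top" unfolding D_def by (intro tendsto_intros lim)
  hence "((\<lambda>y. - D y) \<longlongrightarrow> 0) at_top" using tendsto_minus by fastforce
  hence "0 \<le> - D N"
  proof (rule limit_at_top_le_nonincreasing[OF DERIV_minus[OF dD], rotated])
    show "- (- (\<alpha> + m) * D y + (u y - q) * e y) \<le> 0" if "y \<ge> N" for y
    proof -
      have "(\<alpha> + m) * D y \<le> 0" using m_neg D[of y] by (intro mult_nonpos_nonneg) auto
      moreover have "(u y - q) * e y > 0" using N[OF that] uq[of y] by simp
      ultimately show ?thesis by (simp add: algebra_simps)
    qed
  qed
  thus False using D[of N] by simp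
qed

text \<open>LaSalle's argument in analytic form: H is bounded and monotone, so its derivative -
  \<alpha> p^2 tends to 0, and then p' and g (u y) do. The limit is not a, since the energy would
  have to return to - G a, and not q when q < r.\<close>

lemma excess_neg_limit:
  assumes u: "\<And>y. u y < a" and ex: "excess < 0"
  shows "(u \<longlongrightarrow> r) at_top" "(p \<longlongrightarrow> 0) at_top"
proof -
  have uq: "q < u y" for y by (rule excess_neg_above_q[OF u ex])
  define g' where "g' x = (x - q) * (x - r) + (x - a) * (x - r) + (x - a) * (x - q)" for x
  have dg: "(g has_real_derivative g' x) (at x)" for x
    unfolding g_def[abs_def] g'_def by (auto intro!: derivative_eq_intros simp: algebra_simps)
  have bdd: "\<exists>B. \<forall>y. \<bar>f (u y)\<bar> \<le> B" if "continuous_on {q..a} f" for f :: "real \<Rightarrow> real"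
  proof -
    have "bounded (f ` {q..a})" using that by (intro compact_imp_bounded compact_continuous_image) auto
    then obtain B where "\<forall>x\<in>{q..a}. \<bar>f x\<bar> \<le> B" by (auto simp: bounded_iff)
    moreover have "u y \<in> {q..a}" for y using u[of y] uq[of y] by simp
    ultimately show ?thesis by blast
  qed
  obtain B0 where B0: "\<And>y. \<bar>G (u y)\<bar> \<le> B0" using bdd[OF G_cont] by auto
  obtain B1 where B1: "\<And>y. \<bar>g (u y)\<bar> \<le> B1" using bdd[OF g_cont] by auto
  have "continuous_on {q..a} g'" unfolding g'_def by (intro continuous_intros)
  then obtain B2 where B2: "\<And>y. \<bar>g' (u y)\<bar> \<le> B2" using bdd by blast
  define P where "P = sqrt (2 * (B0 - G a))"
  have P: "\<bar>p y\<bar> \<le> P" for y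
  proof -
    have "(p y)^2 \<le> 2 * (B0 - G a)" using H_le[of y] abs_ge_self[of "G (u y)"] B0[of y] by (simp add: H_def)
    thus ?thesis unfolding P_def by (rule real_le_rsqrt[of "\<bar>p y\<bar>", simplified])
  qed
  have P0: "P \<ge> 0" using P[of 0] by linarith
  define p' where "p' y = g (u y) - \<alpha> * p y" for y
  have dp': "(p has_real_derivative p' y) (at y)" for y unfolding p'_def by (rule dp) simp
  have P': "\<bar>p' y\<bar> \<le> B1 + \<alpha> * P" for y
  proof -
    have "\<bar>p' y\<bar> \<le> \<bar>g (u y)\<bar> + \<alpha> * \<bar>p y\<bar>"
      unfolding p'_def using abs_triangle_ineq4[of "g (u y)" "\<alpha> * p y"] \<alpha> by (simp add: abs_mult)
    also have "\<dots> \<le> B1 + \<alpha> * P" using B1 P \<alpha> by (intro add_mono mult_left_mono) auto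
    finally show ?thesis .
  qed
  define L where "L = Inf (range H)"
  have H_below: "bdd_below (range H)"
  proof (rule bdd_belowI2)
    show "- B0 \<le> H y" for y
      using B0[of y] zero_le_power2[of "p y"] unfolding H_def by linarith
  qed
  have H_top: "(H \<longlongrightarrow> L) at_top"
  proof (rule decreasing_tendsto)
    show "eventually (\<lambda>y. L \<le> H y) at_top"
      unfolding L_def by (intro always_eventually allI cInf_lower H_below) auto
    show "eventually (\<lambda>y. H y < x) at_top" if x: "L < x" for x
    proof -
      obtain y0 where "H y0 < x" using x cInf_less_iff[OF _ H_below] by (auto simp: L_def)
      thus ?thesis using H_mono
        by (intro eventually_mono[OF eventually_ge_at_top[of y0]]) (meson UNIV_I le_less_trans)
    qed
  qed
  have "((\<lambda>y. - \<alpha> * (p y)^2) \<longlongrightarrow> 0) at_top"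
  proof (rule deriv_tendsto_zero_at_top[OF dH _ _ H_top])
    show "((\<lambda>y. - \<alpha> * (p y)^2) has_real_derivative - \<alpha> * (2 * p y * p' y)) (at y)" for y
      by (auto intro!: derivative_eq_intros dp')
    show "\<bar>- \<alpha> * (2 * p y * p' y)\<bar> \<le> \<alpha> * (2 * P * (B1 + \<alpha> * P))" for y
      using \<alpha> mult_mono[OF P P' P0, of y y] by (simp add: abs_mult mult.assoc)
  qed simp
  hence "((\<lambda>y. - (1 / \<alpha>) * (- \<alpha> * (p y)^2)) \<longlongrightarrow> - (1 / \<alpha>) * 0) at_top" by (intro tendsto_intros)
  hence "((\<lambda>y. (p y)^2) \<longlongrightarrow> 0) at_top" using \<alpha> by simp
  from tendsto_real_sqrt[OF this] show p_top: "(p \<longlongrightarrow> 0) at_top"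
    by (simp add: tendsto_rabs_zero_iff)
  have p'_top: "(p' \<longlongrightarrow> 0) at_top"
  proof (rule deriv_tendsto_zero_at_top[OF dp' _ _ p_top])
    show "(p' has_real_derivative g' (u y) * p y - \<alpha> * p' y) (at y)" for y
      unfolding p'_def[abs_def]
      by (rule DERIV_diff[OF DERIV_chain2[OF dg du] DERIV_cmult[OF dp'[unfolded p'_def[abs_def]]]])
    show "\<bar>g' (u y) * p y - \<alpha> * p' y\<bar> \<le> B2 * P + \<alpha> * (B1 + \<alpha> * P)" for y
    proof -
      have "\<bar>g' (u y) * p y - \<alpha> * p' y\<bar> \<le> \<bar>g' (u y)\<bar> * \<bar>p y\<bar> + \<alpha> * \<bar>p' y\<bar>"
        using abs_triangle_ineq4[of "g' (u y) * p y" "\<alpha> * p' y"] \<alpha> by (simp add: abs_mult)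
      also have "\<dots> \<le> B2 * P + \<alpha> * (B1 + \<alpha> * P)"
        using B2 P P' \<alpha> order_trans[OF abs_ge_zero B2] by (intro add_mono mult_mono) auto
      finally show ?thesis .
    qed
  qed
  have "((\<lambda>y. p' y + \<alpha> * p y) \<longlongrightarrow> 0 + \<alpha> * 0) at_top" by (intro tendsto_intros p'_top p_top)
  hence "((\<lambda>y. g (u y)) \<longlongrightarrow> 0) at_top" by (simp add: p'_def)
  moreover have "{x. g x = 0} = {a, q, r}" by (auto simp: g_def)
  ultimately obtain l where l: "g l = 0" "(u \<longlongrightarrow> l) at_top"
    using converges_to_root[of u q a g] u_cont g_cont u uq by (metis finite.emptyI finite.insertI less_imp_le)
  have "l \<noteq> a"
  proof
    assume "l = a"
    have "(H \<longlongrightarrow> 0^2 / 2 - G a) at_top"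
      unfolding H_def using l(2) \<open>l = a\<close> by (intro tendsto_intros tendsto_G p_top) auto
    hence "- G a \<le> H 0"
      by (intro limit_at_top_le_nonincreasing[OF dH]) (use \<alpha> in auto)
    from energy_eq_imp_rest[OF _ this, of 0] u[of 0] show False by simp
  qed
  moreover have "l \<noteq> q" if "q < r"
    using excess_neg_no_limit_q[OF _ p_top that ex] l(2) by blast
  moreover have "l = a \<or> l = q \<or> l = r" using l(1) by (simp add: g_def)
  ultimately show "(u \<longlongrightarrow> r) at_top" using l(2) roots(1) by (metis order_le_less)
qed

end

section \<open>Travelling waves and the shock set\<close>

context cubic
begin

text \<open>q and r share one speed, minus the second elementary symmetric function of the roots, so
  a single cubic serves both possible right-hand states.\<close>

lemma shock_eq:
  assumes "l = q \<or> l = r"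
  shows "- shock_speed a l * (x - a) + x^3 - a^3 = g x"
  using assms r_eq unfolding g_def shock_speed_def by (elim disjE) algebra+

lemma traveling_waveI:
  assumes l: "l = q \<or> l = r"
    and du: "\<And>y. (u has_real_derivative p y) (at y)"
    and dp: "\<And>y. (p has_real_derivative g (u y) - \<alpha> * p y) (at y)"
    and lim: "(u \<longlongrightarrow> a) at_bot" "(p \<longlongrightarrow> 0) at_bot" "(u \<longlongrightarrow> l) at_top" "(p \<longlongrightarrow> 0) at_top"
  shows "traveling_wave \<alpha> a l u"
proof -
  have "((\<lambda>y. g (u y) - \<alpha> * p y) \<longlongrightarrow> g a - \<alpha> * 0) at_bot"
    by (intro tendsto_intros tendsto_g lim)
  moreover have "((\<lambda>y. g (u y) - \<alpha> * p y) \<longlongrightarrow> g l - \<alpha> * 0) at_top"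
    by (intro tendsto_intros tendsto_g lim)
  moreover have "g a = 0" "g l = 0" using l by (auto simp: g_def)
  ultimately have "((\<lambda>y. g (u y) - \<alpha> * p y) \<longlongrightarrow> 0) at_bot" "((\<lambda>y. g (u y) - \<alpha> * p y) \<longlongrightarrow> 0) at_top"
    by simp_all
  moreover have "l \<noteq> a" using l roots by auto
  ultimately show ?thesis
    unfolding traveling_wave_def shock_eq[OF l] using du dp lim
    by (intro conjI exI[of _ p] exI[of _ "\<lambda>y. g (u y) - \<alpha> * p y"]) auto
qed

lemma traveling_wave_orbit:
  assumes "traveling_wave \<alpha> a l u" and l: "l = q \<or> l = r"
  obtains p where "global_orbit \<alpha> k a q r u p" "(u \<longlongrightarrow> l) at_top" "(p \<longlongrightarrow> 0) at_top"
proof -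
  from assms(1) obtain p p' where
    *: "\<And>y. (u has_real_derivative p y) (at y)" "\<And>y. (p has_real_derivative p' y) (at y)"
      "\<And>y. \<alpha> * p y + p' y = g (u y)"
      "(u \<longlongrightarrow> a) at_bot" "(u \<longlongrightarrow> l) at_top" "(p \<longlongrightarrow> 0) at_bot" "(p \<longlongrightarrow> 0) at_top"
    unfolding traveling_wave_def shock_eq[OF l] by blast
  have "p' y = g (u y) - \<alpha> * p y" for y using *(3)[of y] by simp
  with * have "global_orbit \<alpha> k a q r u p"
    by unfold_locales auto
  with * show ?thesis using that by blast
qed

lemma traveling_wave_q_imp:
  assumes "traveling_wave \<alpha> a q u" and "q < r"
  shows "excess = 0"
proof -
  obtain p where "global_orbit \<alpha> k a q r u p" and lim: "(u \<longlongrightarrow> q) at_top" "(p \<longlongrightarrow> 0) at_top"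
    using traveling_wave_orbit[OF assms(1)] by blast
  then interpret global_orbit \<alpha> k a q r u p by simp
  show ?thesis
    using excess_pos_no_limit[OF lim] excess_neg_no_limit_q[OF lim assms(2)]
    by (cases excess "0::real" rule: linorder_cases) auto
qed

lemma traveling_wave_r_imp:
  assumes "traveling_wave \<alpha> a r u"
  shows "excess < 0 \<or> excess = 0 \<and> q = r"
proof -
  obtain p where "global_orbit \<alpha> k a q r u p" and lim: "(u \<longlongrightarrow> r) at_top" "(p \<longlongrightarrow> 0) at_top"
    using traveling_wave_orbit[OF assms(1)] by blast
  then interpret global_orbit \<alpha> k a q r u p by simp
  show ?thesis
    using excess_pos_no_limit[OF lim] excess_zero_limit[OF lim roots(2)]
    by (cases excess "0::real" rule: linorder_cases) auto
qed

lemma explicit_wave: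
  assumes "excess = 0"
  shows "\<exists>u. traveling_wave \<alpha> a q u"
proof -
  define \<sigma> where "\<sigma> = k * (a - q)"
  have \<sigma>: "\<sigma> > 0" using k q_less_a by (simp add: \<sigma>_def)
  define u where "u y = q + (a - q) / (1 + exp (\<sigma> * y))" for y
  define p where "p y = k * (u y - a) * (u y - q)" for y
  have nz: "1 + exp (\<sigma> * y) \<noteq> 0" for y by (metis add_pos_pos exp_gt_zero less_irrefl zero_less_one)
  have du: "(u has_real_derivative p y) (at y)" for y
  proof -
    let ?e = "exp (\<sigma> * y)"
    have "(u has_real_derivative - ((a - q) * (\<sigma> * ?e)) / (1 + ?e)^2) (at y)"
      unfolding u_def[abs_def] using nz
      by (auto intro!: derivative_eq_intros simp: power2_eq_square)
    moreover have "- ((a - q) * (\<sigma> * ?e)) / (1 + ?e)^2 = p y"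
    proof -
      have "u y - a = - ((a - q) * ?e) / (1 + ?e)" "u y - q = (a - q) / (1 + ?e)"
        using nz[of y] by (simp_all add: u_def field_simps)
      thus ?thesis by (simp add: p_def \<sigma>_def power2_eq_square)
    qed
    ultimately show ?thesis by simp
  qed
  have dp: "(p has_real_derivative g (u y) - \<alpha> * p y) (at y)" for y
  proof -
    have "(p has_real_derivative k * p y * (u y - q) + k * (u y - a) * p y) (at y)"
      unfolding p_def[abs_def] by (auto intro!: derivative_eq_intros du[unfolded p_def[abs_def]])
    moreover have "k * p y * (u y - q) + k * (u y - a) * p y = g (u y) - \<alpha> * p y"
    proof -
      have e: "3 * (a + q) = 2 * k * \<alpha>" using assms by (simp add: excess_def)
      have "2 * (k * p y * (u y - q) + k * (u y - a) * p y) = 2 * (g (u y) - \<alpha> * p y)"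
        using e k(2) r_eq unfolding p_def g_def by algebra
      thus ?thesis by simp
    qed
    ultimately show ?thesis by simp
  qed
  have e_bot: "((\<lambda>y. exp (\<sigma> * y)) \<longlongrightarrow> 0) at_bot"
    using \<sigma> by (intro filterlim_compose[OF exp_at_bot] filterlim_tendsto_pos_mult_at_bot[OF tendsto_const]) (auto simp: filterlim_ident)
  have e_top: "filterlim (\<lambda>y. exp (\<sigma> * y)) at_top at_top"
    using \<sigma> by (intro filterlim_compose[OF exp_at_top] filterlim_tendsto_pos_mult_at_top[OF tendsto_const]) (auto simp: filterlim_ident)
  have u_bot: "(u \<longlongrightarrow> a) at_bot"
  proof -
    have "(u \<longlongrightarrow> q + (a - q) / (1 + 0)) at_bot"
      unfolding u_def by (intro tendsto_intros e_bot) auto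
    thus ?thesis by simp
  qed
  have u_top: "(u \<longlongrightarrow> q) at_top"
  proof -
    have "((\<lambda>y. (a - q) / (1 + exp (\<sigma> * y))) \<longlongrightarrow> 0) at_top"
      by (intro tendsto_divide_0[OF tendsto_const] filterlim_at_top_imp_at_infinity
          filterlim_tendsto_add_at_top[OF tendsto_const] e_top)
    from tendsto_add[OF tendsto_const this, of q] show ?thesis by (simp add: u_def[abs_def])
  qed
  have "(p \<longlongrightarrow> k * (a - a) * (a - q)) at_bot" "(p \<longlongrightarrow> k * (q - a) * (q - q)) at_top"
    unfolding p_def by (intro tendsto_intros u_bot u_top)+
  thus ?thesis using traveling_waveI[OF _ du dp u_bot _ u_top] by auto
qed

lemma classical_wave:
  assumes ex: "excess < 0"
  shows "\<exists>u. traveling_wave \<alpha> a r u"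
proof -
  \<comment> \<open>The derivative of g at a, which is the linear coefficient of g (a + z); the
    quadratic one is 3 a because the roots sum to 0. The window - 3 a \<le> z \<le> 0 covers u in
    [q, a] since q > - 2 a.\<close>
  have "(a - q) * (a - r) > 0" using roots by simp
  then obtain z p where dz: "\<And>y. (z has_real_derivative p y) (at y)"
    and dp: "\<And>y. - (3 * a) \<le> z y \<Longrightarrow> z y \<le> 0 \<Longrightarrow>
      (p has_real_derivative (a - q) * (a - r) * z y + 3 * a * (z y)^2 + (z y)^3 - \<alpha> * p y) (at y)"
    and z_bot: "(z \<longlongrightarrow> 0) at_bot" and p_bot: "(p \<longlongrightarrow> 0) at_bot"
    and z_neg: "eventually (\<lambda>y. z y < 0) at_bot"
    using unstable_orbit[OF a_pos, of "(a - q) * (a - r)" \<alpha>] by metis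
  define u where "u y = a + z y" for y
  have du: "(u has_real_derivative p y) (at y)" for y
    unfolding u_def[abs_def] by (auto intro!: derivative_eq_intros dz)
  have dp: "(p has_real_derivative g (u y) - \<alpha> * p y) (at y)" if "q \<le> u y" "u y \<le> a" for y
  proof -
    have "(a - q) * (a - r) * z y + 3 * a * (z y)^2 + (z y)^3 = g (u y)"
      using r_eq unfolding g_def u_def by algebra
    moreover have "- (3 * a) \<le> z y" "z y \<le> 0" using that roots by (auto simp: u_def)
    ultimately show ?thesis using dp[of y] by simp
  qed
  have u_bot: "(u \<longlongrightarrow> a) at_bot"
    using tendsto_add[OF tendsto_const z_bot, of a] by (simp add: u_def[abs_def])
  have u_cont: "continuous_on UNIV u"
    by (rule DERIV_continuous_on) (auto intro: has_field_derivative_at_within du)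
  \<comment> \<open>One positive product records both exits, at a and at q, so a single hitting time
    treats them together.\<close>
  have stay: "(a - u y) * (u y - q) > 0" for y
  proof (rule ccontr)
    assume b: "\<not> ?thesis"
    have "\<exists>t. (a - u t) * (u t - q) = 0 \<and> (\<forall>x<t. (a - u x) * (u x - q) > 0)"
    proof (rule first_hitting_time[where f = "\<lambda>x. (a - u x) * (u x - q)" and b = y])
      show "continuous_on UNIV (\<lambda>x. (a - u x) * (u x - q))" by (intro continuous_intros u_cont)
      show "eventually (\<lambda>x. (a - u x) * (u x - q) > 0) at_bot"
        using z_neg order_tendstoD(1)[OF u_bot q_less_a] by eventually_elim (simp add: u_def mult_neg_pos)
    qed (use b in simp)
    then obtain t where t: "u t = a \<or> u t = q" "\<And>x. x < t \<Longrightarrow> (a - u x) * (u x - q) > 0" by auto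
    have between: "q < u x \<and> u x < a" if "x < t" for x
      using t(2)[OF that] q_less_a by (auto simp: zero_less_mult_iff)
    have closed_between: "q \<le> u x \<and> u x \<le> a" if "x \<le> t" for x
      using between[of x] t(1) that q_less_a by (cases "x = t") auto
    interpret orbit \<alpha> k a q r u p "{..t}"
      by unfold_locales (use du dp closed_between u_bot p_bot in auto)
    from t(1) show False
    proof
      assume "u t = a"
      from at_a_imp_rest[OF _ this, of "t - 1"] between[of "t - 1"] show False by simp
    next
      assume "u t = q"
      thus False using not_hit_q_if_excess_neg[OF _ between ex] by simp
    qed
  qed
  have between: "q < u y \<and> u y < a" for y
    using stay[of y] q_less_a by (auto simp: zero_less_mult_iff)
  interpret global_orbit \<alpha> k a q r u p
    by unfold_locales (use du dp between u_bot p_bot in \<open>auto intro: less_imp_le\<close>)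
  from traveling_waveI[OF _ du dp u_bot p_bot excess_neg_limit[OF _ ex]] between
  show ?thesis by auto
qed

end

text \<open>Dissipation between the two ends gives \<Phi> l \<ge> \<Phi> a, and the difference
  factors as (l - a)^2 (a^2 - l^2) / 4. No order of the roots enters, since that order is deduced
  from this bound.\<close>

lemma traveling_wave_square_le:
  assumes \<alpha>: "\<alpha> > 0" and tw: "traveling_wave \<alpha> a l u"
  shows "l^2 \<le> a^2"
proof -
  let ?s = "shock_speed a l"
  define \<Phi> where "\<Phi> x = x^4 / 4 - ?s * x^2 / 2 + (?s * a - a^3) * x" for x
  from tw obtain p p' where ne: "l \<noteq> a"
    and du: "\<And>y. (u has_real_derivative p y) (at y)" and dp: "\<And>y. (p has_real_derivative p' y) (at y)"
    and eq: "\<And>y. \<alpha> * p y + p' y = - ?s * (u y - a) + (u y)^3 - a^3"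
    and lim: "(u \<longlongrightarrow> a) at_bot" "(u \<longlongrightarrow> l) at_top" "(p \<longlongrightarrow> 0) at_bot" "(p \<longlongrightarrow> 0) at_top"
    unfolding traveling_wave_def by blast
  define H where "H y = (p y)^2 / 2 - \<Phi> (u y)" for y
  have d\<Phi>: "(\<Phi> has_real_derivative - ?s * (x - a) + x^3 - a^3) (at x)" for x
    unfolding \<Phi>_def[abs_def] by (auto intro!: derivative_eq_intros simp: algebra_simps power2_eq_square power3_eq_cube)
  have dH: "(H has_real_derivative - \<alpha> * (p y)^2) (at y)" for y
  proof -
    have "(H has_real_derivative p y * p' y - (- ?s * (u y - a) + (u y)^3 - a^3) * p y) (at y)"
      unfolding H_def[abs_def]
      by (auto intro!: derivative_eq_intros DERIV_chain2[OF d\<Phi> du] dp)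
    moreover have "p y * p' y - (- ?s * (u y - a) + (u y)^3 - a^3) * p y = - \<alpha> * (p y)^2"
      using eq[of y] by algebra
    ultimately show ?thesis by simp
  qed
  have "(H \<longlongrightarrow> 0^2 / 2 - \<Phi> a) at_bot" "(H \<longlongrightarrow> 0^2 / 2 - \<Phi> l) at_top"
    unfolding H_def \<Phi>_def by (intro tendsto_intros lim; simp)+
  hence "H 0 \<le> - \<Phi> a" "- \<Phi> l \<le> H 0"
    using nonincreasing_le_limit_at_bot[OF dH, of 0 "- \<Phi> a"]
      limit_at_top_le_nonincreasing[OF dH, of 0 "- \<Phi> l"] \<alpha> by auto
  hence "0 \<le> 4 * (\<Phi> l - \<Phi> a)" by simp
  moreover have "4 * (\<Phi> l - \<Phi> a) = (l - a)^2 * (a^2 - l^2)"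
  proof -
    have "4 * \<Phi> x = x^4 - 2 * ?s * x^2 + 4 * (?s * a - a^3) * x" for x by (simp add: \<Phi>_def)
    from this[of l] this[of a] show ?thesis unfolding shock_speed_def by algebra
  qed
  ultimately have "0 \<le> (l - a)^2 * (a^2 - l^2)" by simp
  thus ?thesis using ne by (simp add: zero_le_mult_iff)
qed

section \<open>Reflection symmetry, and evaluation of the shock sets\<close>

lemma traveling_wave_uminus:
  assumes "traveling_wave \<alpha> um up u"
  shows "traveling_wave \<alpha> (- um) (- up) (\<lambda>y. - u y)"
proof -
  from assms obtain p p' where "up \<noteq> um"
    "\<And>y. (u has_real_derivative p y) (at y)" "\<And>y. (p has_real_derivative p' y) (at y)"
    and eq: "\<And>y. \<alpha> * p y + p' y = - shock_speed um up * (u y - um) + (u y)^3 - um^3"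
    and lim: "(u \<longlongrightarrow> um) at_bot" "(u \<longlongrightarrow> up) at_top" "(p \<longlongrightarrow> 0) at_bot" "(p \<longlongrightarrow> 0) at_top"
      "(p' \<longlongrightarrow> 0) at_bot" "(p' \<longlongrightarrow> 0) at_top"
    unfolding traveling_wave_def by blast
  moreover have "\<alpha> * - p y + - p' y = - shock_speed (- um) (- up) * (- u y - - um) + (- u y)^3 - (- um)^3" for y
    using eq[of y] unfolding shock_speed_def by algebra
  ultimately show ?thesis
    unfolding traveling_wave_def
    by (intro conjI exI[of _ "\<lambda>y. - p y"] exI[of _ "\<lambda>y. - p' y"])
       (auto intro!: DERIV_minus tendsto_minus dest: tendsto_minus)
qed

lemma uminus_mem_shock_set: "- up \<in> shock_set \<alpha> (- um) \<longleftrightarrow> up \<in> shock_set \<alpha> um"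
  unfolding shock_set_def using traveling_wave_uminus[of \<alpha> um up] traveling_wave_uminus[of \<alpha> "- um" "- up"]
  by auto

lemma shock_set_zero:
  assumes "\<alpha> > 0"
  shows "shock_set \<alpha> 0 = {}"
proof -
  have False if "traveling_wave \<alpha> 0 l u" for l u
    using traveling_wave_square_le[OF assms that] that by (simp add: traveling_wave_def)
  thus ?thesis by (auto simp: shock_set_def)
qed

lemma cubic_excess:
  assumes "cubic \<alpha> (1 / sqrt 2) a q r"
  shows "cubic.excess \<alpha> (1 / sqrt 2) a q = 3 / 2 * (a + q - alpha_tilde \<alpha> / 2)"
  unfolding cubic.excess_def[OF assms] alpha_tilde_def
  by (simp add: field_simps)

text \<open>The third root is - a - l, so l plays the role of r when l \<ge> - a / 2 and of q
  otherwise. In the first case a + q = - l, so \<open>excess\<close> < 0 reads l > -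
  \<open>alpha_tilde \<alpha>\<close> / 2; in the second \<open>excess\<close> = 0 fixes l.\<close>

lemma mem_shock_set_pos:
  assumes \<alpha>: "\<alpha> > 0" and a: "a > 0"
  shows "l \<in> shock_set \<alpha> a \<longleftrightarrow>
    - a / 2 \<le> l \<and> l < a \<and> (- alpha_tilde \<alpha> / 2 < l \<or> l = - alpha_tilde \<alpha> / 2 \<and> l = - a / 2) \<or>
    l < - a / 2 \<and> l = - a + alpha_tilde \<alpha> / 2"
    (is "?lhs \<longleftrightarrow> ?rhs")
proof -
  have \<alpha>t: "alpha_tilde \<alpha> > 0" using \<alpha> by (simp add: alpha_tilde_def)
  have classical: "cubic \<alpha> (1 / sqrt 2) a (- a - l) l" if "- a / 2 \<le> l" "l < a"
    by unfold_locales (use \<alpha> that in \<open>auto simp: power_divide\<close>)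
  have nonclassical: "cubic \<alpha> (1 / sqrt 2) a l (- a - l)" if "l < - a / 2" "- a \<le> l"
    by unfold_locales (use \<alpha> a that in \<open>auto simp: power_divide\<close>)
  show ?thesis
  proof
    assume ?lhs
    then obtain u where tw: "traveling_wave \<alpha> a l u" by (auto simp: shock_set_def)
    have "\<bar>l\<bar> \<le> \<bar>a\<bar>" using traveling_wave_square_le[OF \<alpha> tw] by (simp add: abs_le_square_iff)
    moreover have "l \<noteq> a" using tw by (simp add: traveling_wave_def)
    ultimately have l: "- a \<le> l" "l < a" using a by auto
    show ?rhs
    proof (cases "- a / 2 \<le> l")
      case True
      from cubic.traveling_wave_r_imp[OF classical[OF True l(2)] tw] cubic_excess[OF classical[OF True l(2)]]
      show ?thesis using True l by auto
    next
      case False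
      hence nc: "cubic \<alpha> (1 / sqrt 2) a l (- a - l)" using nonclassical l by simp
      from cubic.traveling_wave_q_imp[OF nc tw] cubic_excess[OF nc] False
      show ?thesis by auto
    qed
  next
    assume ?rhs
    then consider "- a / 2 \<le> l" "l < a" "- alpha_tilde \<alpha> / 2 < l"
      | "l = - alpha_tilde \<alpha> / 2" "l = - a / 2"
      | "l < - a / 2" "l = - a + alpha_tilde \<alpha> / 2" by blast
    hence "\<exists>u. traveling_wave \<alpha> a l u"
    proof cases
      case 1
      note c = classical[OF 1(1,2)]
      show ?thesis by (rule cubic.classical_wave[OF c]) (use cubic_excess[OF c] 1 in auto)
    next
      case 2
      \<comment> \<open>For the double root l = - a / 2 the logistic profile ending at q also ends
        at r; this happens only for a = \<open>alpha_tilde \<alpha>\<close>.\<close>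
      have c: "cubic \<alpha> (1 / sqrt 2) a l l" using classical 2 a by auto
      show ?thesis by (rule cubic.explicit_wave[OF c]) (use cubic_excess[OF c] 2 in auto)
    next
      case 3
      have c: "cubic \<alpha> (1 / sqrt 2) a l (- a - l)" using nonclassical 3 \<alpha>t by auto
      show ?thesis by (rule cubic.explicit_wave[OF c]) (use cubic_excess[OF c] 3 in auto)
    qed
    thus ?lhs by (simp add: shock_set_def)
  qed
qed

lemma mem_shock_set_neg:
  assumes \<alpha>: "\<alpha> > 0" and a: "a < 0"
  shows "l \<in> shock_set \<alpha> a \<longleftrightarrow>
    a < l \<and> l \<le> - a / 2 \<and> (l < alpha_tilde \<alpha> / 2 \<or> l = alpha_tilde \<alpha> / 2 \<and> l = - a / 2) \<or>
    - a / 2 < l \<and> l = - a - alpha_tilde \<alpha> / 2"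
proof -
  have "- a > 0" using a by simp
  thus ?thesis
    unfolding uminus_mem_shock_set[of l \<alpha> a, symmetric] mem_shock_set_pos[OF \<alpha> \<open>- a > 0\<close>]
    by linarith
qed

section \<open>Nonclassical states and the kinetic function\<close>

lemma nonclassical_state_iff:
  "nonclassical_state \<alpha> um up \<longleftrightarrow> up \<in> shock_set \<alpha> um \<and> um * up < 0 \<and> \<bar>up\<bar> > \<bar>um\<bar> / 2"
  by (simp add: nonclassical_state_def shock_set_def)

text \<open>The condition C decides existence and the equation with v gives uniqueness, so one
  equivalence evaluates the definite description.\<close>

lemma kinetic_function_eq:
  assumes "\<And>up. nonclassical_state \<alpha> um up \<longleftrightarrow> C \<and> up = v"
  shows "kinetic_function \<alpha> um = (if C then v else - um / 2)"
proof -
  have "nonclassical_state \<alpha> um = (\<lambda>up. C \<and> up = v)" using assms by auto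
  thus ?thesis by (simp add: kinetic_function_def)
qed

text \<open>Strict because at um = \<open>alpha_tilde \<alpha>\<close> the candidate is - um / 2,
  which only attains the bound on |up|; the default value of the kinetic function agrees with it
  there.\<close>

lemma nonclassical_state_pos:
  assumes "\<alpha> > 0" "um > 0"
  shows "nonclassical_state \<alpha> um up \<longleftrightarrow> um > alpha_tilde \<alpha> \<and> up = - um + alpha_tilde \<alpha> / 2"
  using assms unfolding nonclassical_state_iff mem_shock_set_pos[OF assms]
  by (auto simp: mult_less_0_iff)

lemma nonclassical_state_neg:
  assumes "\<alpha> > 0" "um < 0"
  shows "nonclassical_state \<alpha> um up \<longleftrightarrow> um < - alpha_tilde \<alpha> \<and> up = - um - alpha_tilde \<alpha> / 2"
  using assms unfolding nonclassical_state_iff mem_shock_set_neg[OF assms]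
  by (auto simp: mult_less_0_iff)

lemma kinetic_function_pos:
  assumes "\<alpha> > 0" "um > 0"
  shows "kinetic_function \<alpha> um = (if um > alpha_tilde \<alpha> then - um + alpha_tilde \<alpha> / 2 else - um / 2)"
  by (rule kinetic_function_eq) (rule nonclassical_state_pos[OF assms])

lemma kinetic_function_neg:
  assumes "\<alpha> > 0" "um < 0"
  shows "kinetic_function \<alpha> um = (if um < - alpha_tilde \<alpha> then - um - alpha_tilde \<alpha> / 2 else - um / 2)"
  by (rule kinetic_function_eq) (rule nonclassical_state_neg[OF assms])

lemma kinetic_function_zero: "kinetic_function \<alpha> 0 = 0"
  by (simp add: kinetic_function_def nonclassical_state_def)

theorem theorem3p3:
  fixes \<alpha> um :: real
  assumes "\<alpha> > 0"
  shows
    "(um \<le> - alpha_tilde \<alpha> \<longrightarrow> kinetic_function \<alpha> um = - um - alpha_tilde \<alpha> / 2) \<and>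
     (\<bar>um\<bar> \<le> alpha_tilde \<alpha> \<longrightarrow> kinetic_function \<alpha> um = - um / 2) \<and>
     (um \<ge> alpha_tilde \<alpha> \<longrightarrow> kinetic_function \<alpha> um = - um + alpha_tilde \<alpha> / 2) \<and>
     (um \<le> - alpha_tilde \<alpha> \<longrightarrow>
        shock_set \<alpha> um = {um <..< alpha_tilde \<alpha> / 2} \<union> {- um - alpha_tilde \<alpha> / 2}) \<and>
     (- alpha_tilde \<alpha> \<le> um \<and> um \<le> alpha_tilde \<alpha> \<and> um \<ge> 0 \<longrightarrow>
        shock_set \<alpha> um = {- um / 2 ..< um}) \<and>
     (- alpha_tilde \<alpha> \<le> um \<and> um \<le> alpha_tilde \<alpha> \<and> um \<le> 0 \<longrightarrow>
        shock_set \<alpha> um = {um <.. - um / 2}) \<and>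
     (um \<ge> alpha_tilde \<alpha> \<longrightarrow>
        shock_set \<alpha> um = {- um + alpha_tilde \<alpha> / 2} \<union> {- alpha_tilde \<alpha> / 2 <..< um})"
proof -
  have \<alpha>t: "alpha_tilde \<alpha> > 0" using assms by (simp add: alpha_tilde_def)
  consider "um > 0" | "um = 0" | "um < 0" by linarith
  thus ?thesis
  proof cases
    case 1
    note mem = mem_shock_set_pos[OF assms 1]
    \<comment> \<open>At um = \<open>alpha_tilde \<alpha>\<close> the isolated point is -
      \<open>alpha_tilde \<alpha>\<close> / 2 and closes the open interval, so this form agrees with
      the half-closed one.\<close>
    have "shock_set \<alpha> um = {- um + alpha_tilde \<alpha> / 2} \<union> {- alpha_tilde \<alpha> / 2 <..< um}" if "um \<ge> alpha_tilde \<alpha>"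
      by (rule set_eqI) (unfold mem, use that \<alpha>t in auto)
    moreover have "shock_set \<alpha> um = {- um / 2 ..< um}" if "um \<le> alpha_tilde \<alpha>"
      by (rule set_eqI) (unfold mem, use that 1 \<alpha>t in auto)
    ultimately show ?thesis using 1 \<alpha>t by (auto simp: kinetic_function_pos[OF assms 1])
  next
    case 2
    thus ?thesis using \<alpha>t by (auto simp: kinetic_function_zero shock_set_zero[OF assms])
  next
    case 3
    note mem = mem_shock_set_neg[OF assms 3]
    have "shock_set \<alpha> um = {um <..< alpha_tilde \<alpha> / 2} \<union> {- um - alpha_tilde \<alpha> / 2}" if "um \<le> - alpha_tilde \<alpha>"
      by (rule set_eqI) (unfold mem, use that \<alpha>t in auto)
    moreover have "shock_set \<alpha> um = {um <.. - um / 2}" if "- alpha_tilde \<alpha> \<le> um"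
      by (rule set_eqI) (unfold mem, use that 3 \<alpha>t in auto)
    ultimately show ?thesis using 3 \<alpha>t by (auto simp: kinetic_function_neg[OF assms 3])
  qed
qed

end
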